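(* Let $\boldsymbol{\Pi}\in\mathbb{C}^{N\times N}$ be Hermitian positive semidefinite, and let $P>0$, $\tau>0$. Consider the problem with variable $\boldsymbol{F}\in\mathbb{C}^{N\times L}$ $$\max_{\boldsymbol{F}}\ \boldsymbol{F}^{\rm H}\boldsymbol{\Pi}\boldsymbol{F}\quad\text{s.t.}\quad {\rm Tr}(\boldsymbol{F}\boldsymbol{F}^{\rm H})\le P,\quad \boldsymbol{F}\boldsymbol{F}^{\rm H}\preceq\tau\boldsymbol{I}.$$ Every Pareto optimal solution $\boldsymbol{F}_{\rm opt}$ has the structure $$\boldsymbol{F}_{\rm opt}=\boldsymbol{U}_{\boldsymbol{\Pi}}\boldsymbol{\Lambda}_{\boldsymbol{F}}\boldsymbol{U}_{\rm Arb}^{\rm H},$$ where $\boldsymbol{U}_{\boldsymbol{\Pi}}$ is an $N\times N$ unitary matrix from an eigenvalue decomposition $\boldsymbol{\Pi}=\boldsymbol{U}_{\boldsymbol{\Pi}}\boldsymbol{\Lambda}_{\boldsymbol{\Pi}}\boldsymbol{U}_{\boldsymbol{\Pi}}^{\rm H}$ with the diagonal entries of $\boldsymbol{\Lambda}_{\boldsymbol{\Pi}}$ in descending order, $\boldsymbol{\Lambda}_{\boldsymbol{F}}$ is an $N\times L$ rectangular diagonal matrix with nonnegative diagonal entries, each at most $\sqrt{\tau}$, and $\boldsymbol{U}_{\rm Arb}$ is some $L\times L$ unitary matrix.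
   Context: $(\cdot)^{\rm H}$ is the conjugate transpose and $\preceq,\succeq$ denote the Loewner order on Hermitian matrices. Pareto optimality: a feasible $\boldsymbol{F}$ is a Pareto optimal solution if there is no feasible $\boldsymbol{F}'$ with $\boldsymbol{F}'^{\rm H}\boldsymbol{\Pi}\boldsymbol{F}'\succeq\boldsymbol{F}^{\rm H}\boldsymbol{\Pi}\boldsymbol{F}$ and $\boldsymbol{F}'^{\rm H}\boldsymbol{\Pi}\boldsymbol{F}'\ne\boldsymbol{F}^{\rm H}\boldsymbol{\Pi}\boldsymbol{F}$. The eigenvalue decomposition of $\boldsymbol{\Pi}$ need not be unique; the statement means that the structure holds for some choice of it. *)

theory Defs
  imports "Jordan_Normal_Form.Schur_Decomposition" Complex_Main
begin

text \<open>Inequalities between complex numbers refer to the order of \<^theory>\<open>HOL-Library.Complex_Order\<close>: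
  \<open>z \<le> w\<close> means \<open>Re z \<le> Re w\<close> and \<open>Im z = Im w\<close>.  In particular \<open>0 \<le> z\<close> says that \<open>z\<close> is
  real and nonnegative.\<close>

definition mat_trace :: "complex mat \<Rightarrow> complex" where
  "mat_trace A = (\<Sum>i<dim_row A. A $$ (i, i))"

definition hermitian_mat :: "nat \<Rightarrow> complex mat \<Rightarrow> bool" where
  "hermitian_mat n A \<longleftrightarrow> A \<in> carrier_mat n n \<and> mat_adjoint A = A"

definition unitary_mat :: "nat \<Rightarrow> complex mat \<Rightarrow> bool" where
  "unitary_mat n U \<longleftrightarrow>
     U \<in> carrier_mat n n \<and> mat_adjoint U * U = 1\<^sub>m n \<and> U * mat_adjoint U = 1\<^sub>m n"

text \<open>Since \<open>\<bullet>c\<close> conjugates its second argument, \<open>(A *\<^sub>v v) \<bullet>c v\<close> is the quadratic form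
  of \<open>A\<close> at \<open>v\<close>.\<close>

definition psd_mat :: "nat \<Rightarrow> complex mat \<Rightarrow> bool" where
  "psd_mat n A \<longleftrightarrow> hermitian_mat n A \<and> (\<forall>v \<in> carrier_vec n. 0 \<le> (A *\<^sub>v v) \<bullet>c v)"

definition loewner_le :: "nat \<Rightarrow> complex mat \<Rightarrow> complex mat \<Rightarrow> bool" where
  "loewner_le n A B \<longleftrightarrow> hermitian_mat n A \<and> hermitian_mat n B \<and> psd_mat n (B - A)"

definition feasible :: "nat \<Rightarrow> nat \<Rightarrow> real \<Rightarrow> real \<Rightarrow> complex mat \<Rightarrow> bool" where
  "feasible N L P \<tau> F \<longleftrightarrow>
     F \<in> carrier_mat N L \<and>
     mat_trace (F * mat_adjoint F) \<le> complex_of_real P \<and>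
     loewner_le N (F * mat_adjoint F) (complex_of_real \<tau> \<cdot>\<^sub>m 1\<^sub>m N)"

definition objective :: "complex mat \<Rightarrow> complex mat \<Rightarrow> complex mat" where
  "objective Q F = mat_adjoint F * Q * F"

definition pareto_optimal ::
  "nat \<Rightarrow> nat \<Rightarrow> real \<Rightarrow> real \<Rightarrow> complex mat \<Rightarrow> complex mat \<Rightarrow> bool" where
  "pareto_optimal N L P \<tau> Q F \<longleftrightarrow>
     feasible N L P \<tau> F \<and>
     \<not> (\<exists>F'. feasible N L P \<tau> F' \<and>
            loewner_le L (objective Q F) (objective Q F') \<and>
            objective Q F' \<noteq> objective Q F)"

definition descending_evd :: "nat \<Rightarrow> complex mat \<Rightarrow> complex mat \<Rightarrow> complex mat \<Rightarrow> bool" where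
  "descending_evd n A U D \<longleftrightarrow>
     unitary_mat n U \<and> D \<in> carrier_mat n n \<and> diagonal_mat D \<and>
     A = U * D * mat_adjoint U \<and>
     (\<forall>i<n. D $$ (i, i) \<in> \<real>) \<and>
     (\<forall>i j. i \<le> j \<longrightarrow> j < n \<longrightarrow> D $$ (j, j) \<le> D $$ (i, i))"

end

theory Submission
  imports Defs "Jordan_Normal_Form.Spectral_Radius"
begin

text \<open>The structure is obtained by deflating one singular pair at a time: if \<open>u\<close> is a unit
  eigenvector of \<open>Q\<close> for its largest eigenvalue \<open>k\<close> and \<open>F v = s u\<close>, \<open>F\<^sup>H u = s v\<close>, then \<open>F\<close> and
  \<open>Q\<close> split off a \<open>1 \<times> 1\<close> block, and the remaining block of \<open>F\<close> is Pareto optimal for the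
  remaining block of \<open>Q\<close> with power \<open>P - s\<^sup>2\<close>.

  To find such a pair, let \<open>\<mu>\<close> be the largest eigenvalue of \<open>F\<^sup>H Q F\<close>; always \<open>\<mu> \<le> \<tau> k\<close>.  If
  equality holds with \<open>k > 0\<close>, a top eigenvector of \<open>F\<^sup>H Q F\<close> works with \<open>s = sqrt \<tau>\<close>.  Otherwise
  let \<open>u\<close> be any top eigenvector of \<open>Q\<close> and \<open>v\<close> a unit vector with \<open>F\<^sup>H u\<close> parallel to \<open>v\<close>.
  Replace the column \<open>F v\<close> by a multiple of \<open>u\<close>, and shrink the columns on the orthogonal
  complement of \<open>v\<close> so that their contribution to the objective drops from the eigenvalues of
  the compression of \<open>F\<^sup>H Q F\<close> to its second, third, ... eigenvalues, which are smaller by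
  interlacing.  Unless \<open>F v\<close> is itself a top eigenvector of \<open>Q\<close>, the power saved lets the new
  column exceed \<open>\<mu>\<close>, against Pareto optimality.  So \<open>F F\<^sup>H\<close> leaves the top eigenspace of \<open>Q\<close>
  invariant, and an eigenvector of \<open>F F\<^sup>H\<close> in it provides the pair.\<close>

section \<open>Adjoints, unitary matrices and block extension\<close>

lemma mat_adjoint_dim [simp]:
  "dim_row (mat_adjoint A) = dim_col A" "dim_col (mat_adjoint A) = dim_row A"
  by (simp_all add: mat_adjoint_def)

lemma mat_adjoint_carrier [simp]:
  "A \<in> carrier_mat n m \<Longrightarrow> mat_adjoint A \<in> carrier_mat m n"
  by (auto intro: carrier_matI)

lemma mat_adjoint_index [simp]:
  fixes A :: "complex mat"
  assumes "i < dim_col A" "j < dim_row A"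
  shows "mat_adjoint A $$ (i, j) = cnj (A $$ (j, i))"
  using assms by (simp add: mat_adjoint_def mat_of_rows_index)

lemma mat_adjoint_adjoint [simp]: "mat_adjoint (mat_adjoint (A :: complex mat)) = A"
  by (rule eq_matI) simp_all

lemma mat_adjoint_one [simp]: "mat_adjoint (1\<^sub>m n :: complex mat) = 1\<^sub>m n"
  by (rule eq_matI) auto

lemma mat_adjoint_mult:
  fixes A B :: "complex mat"
  assumes "A \<in> carrier_mat n k" "B \<in> carrier_mat k m"
  shows "mat_adjoint (A * B) = mat_adjoint B * mat_adjoint A"
  using assms by (intro eq_matI) (auto simp: scalar_prod_def mult.commute)

text \<open>Both sides expand to the same double sum, summed in opposite orders.\<close>

lemma cscalar_prod_mult_mat_vec:
  fixes A :: "complex mat"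
  assumes "A \<in> carrier_mat n m" "x \<in> carrier_vec m" "y \<in> carrier_vec n"
  shows "(A *\<^sub>v x) \<bullet>c y = x \<bullet>c (mat_adjoint A *\<^sub>v y)"
proof -
  have "(A *\<^sub>v x) \<bullet>c y = (\<Sum>i<n. \<Sum>j<m. A $$ (i, j) * x $ j * cnj (y $ i))"
    using assms by (auto simp: scalar_prod_def sum_distrib_right atLeast0LessThan intro!: sum.cong)
  also have "\<dots> = (\<Sum>j<m. \<Sum>i<n. A $$ (i, j) * x $ j * cnj (y $ i))"
    by (rule sum.swap)
  also have "\<dots> = x \<bullet>c (mat_adjoint A *\<^sub>v y)"
    using assms by (auto simp: scalar_prod_def sum_distrib_left atLeast0LessThan mult_ac intro!: sum.cong)
  finally show ?thesis .
qed

lemma mult_carrier_iff [simp]: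
  "A * B \<in> carrier_mat n m \<longleftrightarrow> dim_row A = n \<and> dim_col B = m"
  by (metis carrier_matD carrier_matI index_mult_mat(2,3))

lemma mult_vec_carrier_iff [simp]: "A *\<^sub>v x \<in> carrier_vec n \<longleftrightarrow> dim_row A = n"
  by (metis carrier_vecD carrier_vecI dim_mult_mat_vec)

text \<open>Premises on dimensions instead of carriers leave no intermediate dimension to guess, so
  this serves as a conditional rewrite rule. The next two lemmas follow the same pattern.\<close>

lemma assoc_mult_mat_dim:
  fixes A B C :: "'a :: semiring_0 mat"
  shows "dim_col A = dim_row B \<Longrightarrow> dim_col B = dim_row C \<Longrightarrow> A * B * C = A * (B * C)"
  by (metis assoc_mult_mat carrier_matI)

lemma assoc_mult_mat_vec_dim:
  fixes A B :: "'a :: semiring_0 mat"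
  shows "dim_col A = dim_row B \<Longrightarrow> dim_col B = dim_vec x \<Longrightarrow> A * B *\<^sub>v x = A *\<^sub>v (B *\<^sub>v x)"
  by (metis assoc_mult_mat_vec carrier_matI carrier_vecI)

lemma mat_adjoint_mult_dim:
  fixes A B :: "complex mat"
  shows "dim_col A = dim_row B \<Longrightarrow> mat_adjoint (A * B) = mat_adjoint B * mat_adjoint A"
  by (metis mat_adjoint_mult carrier_matI)

lemma mult_mat_unit_vec:
  fixes A :: "'a :: semiring_1 mat"
  shows "A \<in> carrier_mat n m \<Longrightarrow> i < m \<Longrightarrow> A *\<^sub>v unit_vec m i = col A i"
  by (intro eq_vecI) auto

section \<open>Squared norms and quadratic forms\<close>

definition vnorm2 :: "complex vec \<Rightarrow> real" where
  "vnorm2 v = (\<Sum>i<dim_vec v. (cmod (v $ i))\<^sup>2)"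

lemma cscalar_prod_self: "v \<bullet>c v = complex_of_real (vnorm2 v)"
  unfolding vnorm2_def scalar_prod_def
  by (simp add: atLeast0LessThan complex_norm_square del: of_real_power)

lemma vnorm2_nonneg [simp]: "0 \<le> vnorm2 v"
  by (simp add: vnorm2_def sum_nonneg)

lemma vnorm2_eq_0: "v \<in> carrier_vec n \<Longrightarrow> vnorm2 v = 0 \<longleftrightarrow> v = 0\<^sub>v n"
  by (auto simp: vnorm2_def sum_nonneg_eq_0_iff intro!: eq_vecI)

lemma vnorm2_zero [simp]: "vnorm2 (0\<^sub>v n) = 0"
  by (simp add: vnorm2_def)

lemma vnorm2_smult [simp]: "vnorm2 (c \<cdot>\<^sub>v v) = (cmod c)\<^sup>2 * vnorm2 v"
  by (simp add: vnorm2_def norm_mult power_mult_distrib sum_distrib_left)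

lemma vnorm2_vCons [simp]: "vnorm2 (vCons a v) = (cmod a)\<^sup>2 + vnorm2 v"
  by (simp only: vnorm2_def dim_vec_vCons sum.lessThan_Suc_shift vec_index_vCons_0)
     (simp add: vec_index_vCons)

lemma vnorm2_unit_vec [simp]: "i < n \<Longrightarrow> vnorm2 (unit_vec n i) = 1"
proof -
  assume "i < n"
  then have "vnorm2 (unit_vec n i) = (\<Sum>j<n. if j = i then 1 else 0)"
    unfolding vnorm2_def by (intro sum.cong) auto
  then show ?thesis using \<open>i < n\<close> by simp
qed

lemma vnorm2_mult_mat_vec:
  assumes "A \<in> carrier_mat n m" "x \<in> carrier_vec m"
  shows "complex_of_real (vnorm2 (A *\<^sub>v x)) = x \<bullet>c (mat_adjoint A *\<^sub>v (A *\<^sub>v x))"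
  using cscalar_prod_mult_mat_vec[of A n m x "A *\<^sub>v x"] assms by (simp add: cscalar_prod_self)

text \<open>Taking the real part allows comparison in the reals. For Hermitian \<open>A\<close>
  nothing is lost, by \<open>hermitian_cscalar_prod\<close>.\<close>

definition quad_form :: "complex mat \<Rightarrow> complex vec \<Rightarrow> real" where
  "quad_form A v = Re ((A *\<^sub>v v) \<bullet>c v)"

section \<open>Unitary matrices\<close>

lemma unitary_matD:
  assumes "unitary_mat n U"
  shows "U \<in> carrier_mat n n" "mat_adjoint U * U = 1\<^sub>m n" "U * mat_adjoint U = 1\<^sub>m n"
  using assms by (auto simp: unitary_mat_def)

lemma unitary_mat_adjoint: "unitary_mat n U \<Longrightarrow> unitary_mat n (mat_adjoint U)"
  by (simp add: unitary_mat_def)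

lemma unitary_mat_one: "unitary_mat n (1\<^sub>m n)"
  by (simp add: unitary_mat_def)

text \<open>Products get associated to the right, so cancellation is stated for a unitary matrix and
  its adjoint standing in front of a further factor.\<close>

lemma unitary_mat_cancel [simp]:
  assumes "unitary_mat n U" "A \<in> carrier_mat n m"
  shows "mat_adjoint U * (U * A) = A" "U * (mat_adjoint U * A) = A"
  using assms assoc_mult_mat[of "mat_adjoint U" n n U n A m]
    assoc_mult_mat[of U n n "mat_adjoint U" n A m]
  by (simp_all add: unitary_mat_def)

lemma unitary_mat_cancel_vec [simp]:
  assumes "unitary_mat n U" "x \<in> carrier_vec n"
  shows "mat_adjoint U *\<^sub>v (U *\<^sub>v x) = x" "U *\<^sub>v (mat_adjoint U *\<^sub>v x) = x"
  using assms assoc_mult_mat_vec[of "mat_adjoint U" n n U n x]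
    assoc_mult_mat_vec[of U n n "mat_adjoint U" n x]
  by (simp_all add: unitary_mat_def)

lemma unitary_mat_mult:
  assumes U: "unitary_mat n U" and V: "unitary_mat n V"
  shows "unitary_mat n (U * V)"
proof -
  note u = unitary_matD[OF U] and v = unitary_matD[OF V]
  have "mat_adjoint V * mat_adjoint U * (U * V) = mat_adjoint V * (mat_adjoint U * (U * V))"
    using u(1) v(1) by (intro assoc_mult_mat) auto
  moreover have "U * V * (mat_adjoint V * mat_adjoint U) = U * (V * (mat_adjoint V * mat_adjoint U))"
    using u(1) v(1) by (intro assoc_mult_mat) auto
  ultimately show ?thesis
    using u v unitary_mat_cancel[OF U, of "V" n] unitary_mat_cancel[OF V, of "mat_adjoint U" n]
    by (simp add: unitary_mat_def mat_adjoint_mult[OF u(1) v(1)])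
qed

lemma vnorm2_unitary:
  assumes "unitary_mat n U" "x \<in> carrier_vec n"
  shows "vnorm2 (U *\<^sub>v x) = vnorm2 x"
  using vnorm2_mult_mat_vec[OF unitary_matD(1)[OF assms(1)] assms(2)] assms
  by (simp add: cscalar_prod_self)

text \<open>A left inverse of a square matrix is also a right inverse.\<close>

lemma unitary_matI:
  assumes "U \<in> carrier_mat n n" "mat_adjoint U * U = 1\<^sub>m n"
  shows "unitary_mat n U"
  using assms mat_mult_left_right_inverse[of "mat_adjoint U" n U] by (simp add: unitary_mat_def)

text \<open>Complete \<open>u\<close> to a basis and orthogonalise. Gram-Schmidt keeps the first
  vector, and normalising it changes nothing because \<open>u\<close> is already a unit
  vector.\<close>

lemma unitary_mat_with_first_col:
  assumes u: "u \<in> carrier_vec n" and u1: "vnorm2 u = 1"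
  shows "\<exists>U. unitary_mat n U \<and> col U 0 = u"
proof -
  have u0: "u \<noteq> 0\<^sub>v n" using u1 by auto
  interpret cof_vec_space n "TYPE(complex)" .
  note bc = basis_completion[OF u u0]
  define ws where "ws = gram_schmidt n (basis_completion u)"
  note gs = gram_schmidt_result[OF bc(2,4,5) ws_def]
  have len: "length ws = n" using gs(4) bc(6) by simp
  have wc: "ws ! i \<in> carrier_vec n" if "i < n" for i
    using gs(3) len that nth_mem by blast
  have "n \<noteq> 0" using u u1 by (cases n) (auto simp: vnorm2_def)
  have "ws ! 0 = hd ws" using len \<open>n \<noteq> 0\<close> by (metis hd_conv_nth list.size(3))
  also have "\<dots> = hd (basis_completion u)"
    unfolding ws_def using u bc(2,6) \<open>n \<noteq> 0\<close> by (cases "basis_completion u") auto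
  finally have w0: "ws ! 0 = u" using bc(7) by simp
  \<comment> \<open>Gram-Schmidt returns orthogonal vectors of arbitrary length, so each column is
    divided by its norm.\<close>
  define U where "U = mat n n (\<lambda>(i, j). (1 / sqrt (vnorm2 (ws ! j))) *\<^sub>R ws ! j $ i)"
  have U: "U \<in> carrier_mat n n" by (simp add: U_def)
  have cU: "col U j = complex_of_real (1 / sqrt (vnorm2 (ws ! j))) \<cdot>\<^sub>v (ws ! j)" if "j < n" for j
    using that wc[OF that] by (intro eq_vecI) (auto simp: U_def scaleR_conv_of_real)
  have "mat_adjoint U * U = 1\<^sub>m n"
  proof (rule eq_matI)
    fix i j assume "i < dim_row (1\<^sub>m n :: complex mat)" "j < dim_col (1\<^sub>m n :: complex mat)"
    then have i: "i < n" and j: "j < n" by auto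
    have "(mat_adjoint U * U) $$ (i, j) = col U j \<bullet>c col U i"
      using i j U by (auto simp: scalar_prod_def mult.commute intro!: sum.cong)
    also have "\<dots> = complex_of_real (1 / sqrt (vnorm2 (ws ! j))) * complex_of_real (1 / sqrt (vnorm2 (ws ! i))) * (ws ! j \<bullet>c ws ! i)"
      using wc[OF i] wc[OF j] by (simp add: cU i j conjugate_smult_vec)
    also have "\<dots> = 1\<^sub>m n $$ (i, j)"
    proof (cases "i = j")
      case True
      have "ws ! i \<bullet>c ws ! i \<noteq> 0" using corthogonalD[OF gs(2), of i i] i len by auto
      then have "vnorm2 (ws ! i) \<noteq> 0" by (auto simp: cscalar_prod_self)
      then have "1 / sqrt (vnorm2 (ws ! i)) * (1 / sqrt (vnorm2 (ws ! i))) * vnorm2 (ws ! i) = 1"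
        by (simp add: field_simps)
      then have "complex_of_real (1 / sqrt (vnorm2 (ws ! i)) * (1 / sqrt (vnorm2 (ws ! i))) * vnorm2 (ws ! i)) = 1"
        by simp
      then show ?thesis using True i by (simp only: of_real_mult cscalar_prod_self) simp
    next
      case False
      then show ?thesis using corthogonalD[OF gs(2), of j i] i j len by auto
    qed
    finally show "(mat_adjoint U * U) $$ (i, j) = 1\<^sub>m n $$ (i, j)" .
  qed (use U in auto)
  then have "unitary_mat n U" using U by (rule unitary_matI[rotated])
  moreover have "col U 0 = u" using cU[of 0] \<open>n \<noteq> 0\<close> u1 w0 by simp
  ultimately show ?thesis by blast
qed

text \<open>The block diagonal matrix with blocks \<open>s\<close> and \<open>A\<close>, where
  \<open>A\<close> may be rectangular or empty. The entrywise form lets index arguments split into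
  \<open>0\<close> and \<open>Suc\<close>.\<close>

definition diag_ext :: "complex \<Rightarrow> complex mat \<Rightarrow> complex mat" where
  "diag_ext s A = mat (Suc (dim_row A)) (Suc (dim_col A))
     (\<lambda>(i, j). if i = 0 \<and> j = 0 then s else if i = 0 \<or> j = 0 then 0 else A $$ (i - 1, j - 1))"

lemma diag_ext_dim [simp]:
  "dim_row (diag_ext s A) = Suc (dim_row A)" "dim_col (diag_ext s A) = Suc (dim_col A)"
  by (simp_all add: diag_ext_def)

lemma diag_ext_carrier [simp]:
  "diag_ext s A \<in> carrier_mat (Suc n) (Suc m) \<longleftrightarrow> A \<in> carrier_mat n m"
  by (metis Suc_inject carrier_matD carrier_matI diag_ext_dim)

lemma diag_ext_index [simp]:
  "diag_ext s A $$ (0, 0) = s"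
  "i < dim_row A \<Longrightarrow> diag_ext s A $$ (Suc i, 0) = 0"
  "j < dim_col A \<Longrightarrow> diag_ext s A $$ (0, Suc j) = 0"
  "i < dim_row A \<Longrightarrow> j < dim_col A \<Longrightarrow> diag_ext s A $$ (Suc i, Suc j) = A $$ (i, j)"
  by (simp_all add: diag_ext_def)

text \<open>The case split follows the index rules of \<open>diag_ext\<close>: corner, first column,
  first row, inner block.\<close>

lemma eq_mat_SucI:
  assumes "A \<in> carrier_mat (Suc n) (Suc m)" "B \<in> carrier_mat (Suc n) (Suc m)"
    and "A $$ (0, 0) = B $$ (0, 0)"
    and "\<And>i. i < n \<Longrightarrow> A $$ (Suc i, 0) = B $$ (Suc i, 0)"
    and "\<And>j. j < m \<Longrightarrow> A $$ (0, Suc j) = B $$ (0, Suc j)"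
    and "\<And>i j. i < n \<Longrightarrow> j < m \<Longrightarrow> A $$ (Suc i, Suc j) = B $$ (Suc i, Suc j)"
  shows "A = B"
proof (rule eq_matI)
  fix i j assume "i < dim_row B" "j < dim_col B"
  then show "A $$ (i, j) = B $$ (i, j)" using assms by (cases i; cases j) auto
qed (use assms in auto)

lemma diag_ext_mult:
  assumes "A \<in> carrier_mat n k" "B \<in> carrier_mat k m"
  shows "diag_ext s A * diag_ext t B = diag_ext (s * t) (A * B)"
  using assms
  by (intro eq_mat_SucI[of _ n m])
     (auto simp: scalar_prod_def sum.atLeast0_lessThan_Suc_shift simp del: sum.op_ivl_Suc)

lemma diag_ext_adjoint: "mat_adjoint (diag_ext s A) = diag_ext (cnj s) (mat_adjoint A)"
proof -
  have "A \<in> carrier_mat (dim_row A) (dim_col A)" by simp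
  then show ?thesis by (intro eq_mat_SucI[of _ "dim_col A" "dim_row A"]) simp_all
qed

lemma diag_ext_one: "diag_ext 1 (1\<^sub>m n) = 1\<^sub>m (Suc n)"
  by (intro eq_mat_SucI[of _ n n]) auto

lemma unitary_diag_ext:
  assumes "unitary_mat n U"
  shows "unitary_mat (Suc n) (diag_ext 1 U)"
proof -
  note U = unitary_matD[OF assms]
  show ?thesis
    using U diag_ext_mult[of "mat_adjoint U" n n U n 1 1] diag_ext_mult[of U n n "mat_adjoint U" n 1 1]
    by (simp add: unitary_mat_def diag_ext_adjoint diag_ext_one)
qed

lemma diag_ext_mult_vec:
  assumes "A \<in> carrier_mat n m" "x \<in> carrier_vec m"
  shows "diag_ext s A *\<^sub>v vCons a x = vCons (s * a) (A *\<^sub>v x)"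
proof (rule eq_vecI)
  fix i assume "i < dim_vec (vCons (s * a) (A *\<^sub>v x))"
  then show "(diag_ext s A *\<^sub>v vCons a x) $ i = vCons (s * a) (A *\<^sub>v x) $ i"
    using assms
    by (cases i) (auto simp: scalar_prod_def sum.atLeast0_lessThan_Suc_shift simp del: sum.op_ivl_Suc)
qed (use assms in auto)

lemma diag_ext_diagonal: "diagonal_mat A \<Longrightarrow> diagonal_mat (diag_ext s A)"
  unfolding diagonal_mat_def diag_ext_dim
proof (intro allI impI)
  fix i j assume "\<forall>i<dim_row A. \<forall>j<dim_col A. i \<noteq> j \<longrightarrow> A $$ (i, j) = 0"
    "i < Suc (dim_row A)" "j < Suc (dim_col A)" "i \<noteq> j"
  then show "diag_ext s A $$ (i, j) = 0" by (cases i; cases j) auto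
qed

section \<open>Hermitian matrices and the spectral theorem\<close>

lemma cscalar_prod_commute:
  fixes x y :: "complex vec"
  assumes "x \<in> carrier_vec n" "y \<in> carrier_vec n"
  shows "y \<bullet>c x = cnj (x \<bullet>c y)"
  using assms by (auto simp: scalar_prod_def mult.commute intro!: sum.cong)

lemma hermitian_matD:
  assumes "hermitian_mat n A"
  shows "A \<in> carrier_mat n n" "mat_adjoint A = A"
  using assms by (auto simp: hermitian_mat_def)

text \<open>Moving \<open>A\<close> to the other argument shows that the value equals its own
  conjugate, hence is real.\<close>

lemma hermitian_cscalar_prod:
  assumes "hermitian_mat n A" "x \<in> carrier_vec n"
  shows "(A *\<^sub>v x) \<bullet>c x = complex_of_real (quad_form A x)"
proof -
  note A = hermitian_matD[OF assms(1)]
  have "(A *\<^sub>v x) \<bullet>c x = x \<bullet>c (A *\<^sub>v x)"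
    using cscalar_prod_mult_mat_vec[OF A(1) assms(2) assms(2)] A(2) by simp
  also have "\<dots> = cnj ((A *\<^sub>v x) \<bullet>c x)"
    using A(1) assms(2) by (intro cscalar_prod_commute[of _ n]) auto
  finally show ?thesis
    by (metis quad_form_def Reals_cnj_iff complex_is_Real_iff of_real_Re)
qed

lemma psd_mat_iff:
  "psd_mat n A \<longleftrightarrow> hermitian_mat n A \<and> (\<forall>x \<in> carrier_vec n. 0 \<le> quad_form A x)"
  by (auto simp: psd_mat_def hermitian_cscalar_prod less_eq_complex_def)

lemma quad_form_diff:
  assumes "A \<in> carrier_mat n n" "B \<in> carrier_mat n n" "x \<in> carrier_vec n"
  shows "quad_form (B - A) x = quad_form B x - quad_form A x"
proof -
  have "(B - A) *\<^sub>v x = B *\<^sub>v x - A *\<^sub>v x"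
    using assms by (intro minus_mult_distrib_mat_vec)
  moreover have "(B *\<^sub>v x - A *\<^sub>v x) \<bullet>c x = (B *\<^sub>v x) \<bullet>c x - (A *\<^sub>v x) \<bullet>c x"
    using assms by (intro minus_scalar_prod_distrib[of _ n]) auto
  ultimately show ?thesis by (simp add: quad_form_def)
qed

lemma hermitian_mat_diff:
  assumes "hermitian_mat n A" "hermitian_mat n B"
  shows "hermitian_mat n (B - A)"
proof -
  note A = hermitian_matD[OF assms(1)] and B = hermitian_matD[OF assms(2)]
  have "cnj (A $$ (j, i)) = A $$ (i, j)" "cnj (B $$ (j, i)) = B $$ (i, j)"
    if "i < n" "j < n" for i j
    using that A B by (metis carrier_matD mat_adjoint_index)+
  then have "mat_adjoint (B - A) = B - A"
    using A(1) B(1) by (intro eq_matI) auto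
  then show ?thesis using minus_carrier_mat[OF A(1)] B(1) A(1) by (auto simp: hermitian_mat_def)
qed

text \<open>Reduces the Loewner order to pointwise comparison of real quadratic forms, the shape in
  which all later order arguments run.\<close>

lemma loewner_le_iff:
  "loewner_le n A B \<longleftrightarrow> hermitian_mat n A \<and> hermitian_mat n B \<and>
     (\<forall>x \<in> carrier_vec n. quad_form A x \<le> quad_form B x)"
  unfolding loewner_le_def psd_mat_iff
  using quad_form_diff[OF hermitian_matD(1) hermitian_matD(1), of n A B]
  by (auto simp: hermitian_mat_diff)

section \<open>Congruences, the Frobenius norm and feasibility\<close>

lemma hermitian_congruence:
  assumes "hermitian_mat n A" "B \<in> carrier_mat n m"
  shows "hermitian_mat m (mat_adjoint B * A * B)"
proof -
  note A = hermitian_matD[OF assms(1)]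
  show ?thesis
    using A assms(2) by (simp add: hermitian_mat_def mat_adjoint_mult_dim assoc_mult_mat_dim)
qed

lemma quad_form_congruence:
  assumes "A \<in> carrier_mat n n" "B \<in> carrier_mat n m" "x \<in> carrier_vec m"
  shows "quad_form (mat_adjoint B * A * B) x = quad_form A (B *\<^sub>v x)"
  using cscalar_prod_mult_mat_vec[of "mat_adjoint B" m n "A *\<^sub>v (B *\<^sub>v x)" x] assms
  by (simp add: quad_form_def assoc_mult_mat_vec_dim)

text \<open>The squared Frobenius norm, organised by columns because the competing solution is built
  column by column.\<close>

definition frob2 :: "complex mat \<Rightarrow> real" where
  "frob2 F = (\<Sum>j<dim_col F. vnorm2 (col F j))"

lemma mat_trace_mult_adjoint: "mat_trace (F * mat_adjoint F) = complex_of_real (frob2 F)"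
proof -
  have "mat_trace (F * mat_adjoint F) =
      (\<Sum>i<dim_row F. \<Sum>j<dim_col F. complex_of_real ((cmod (F $$ (i, j)))\<^sup>2))"
    unfolding mat_trace_def
    by (auto simp: scalar_prod_def atLeast0LessThan complex_norm_square simp del: of_real_power
        intro!: sum.cong)
  also have "\<dots> = (\<Sum>j<dim_col F. \<Sum>i<dim_row F. complex_of_real ((cmod (F $$ (i, j)))\<^sup>2))"
    by (rule sum.swap)
  also have "\<dots> = complex_of_real (frob2 F)"
    by (simp add: frob2_def vnorm2_def)
  finally show ?thesis .
qed

lemma hermitian_mult_adjoint:
  assumes "F \<in> carrier_mat n m"
  shows "hermitian_mat n (F * mat_adjoint F)"
  using assms mat_adjoint_mult[of F n m "mat_adjoint F" n] by (simp add: hermitian_mat_def)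

lemma quad_form_mult_adjoint:
  assumes "F \<in> carrier_mat n m" "x \<in> carrier_vec n"
  shows "quad_form (F * mat_adjoint F) x = vnorm2 (mat_adjoint F *\<^sub>v x)"
proof -
  have "(F *\<^sub>v (mat_adjoint F *\<^sub>v x)) \<bullet>c x = (mat_adjoint F *\<^sub>v x) \<bullet>c (mat_adjoint F *\<^sub>v x)"
    using assms by (intro cscalar_prod_mult_mat_vec) auto
  then show ?thesis using assms by (simp add: quad_form_def cscalar_prod_self assoc_mult_mat_vec_dim)
qed

lemma hermitian_smult_one: "hermitian_mat n (complex_of_real t \<cdot>\<^sub>m 1\<^sub>m n)"
  unfolding hermitian_mat_def by (auto intro!: eq_matI)

lemma quad_form_smult_one:
  assumes "x \<in> carrier_vec n"
  shows "quad_form (complex_of_real t \<cdot>\<^sub>m 1\<^sub>m n) x = t * vnorm2 x"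
proof -
  have "(complex_of_real t \<cdot>\<^sub>m 1\<^sub>m n) *\<^sub>v x = complex_of_real t \<cdot>\<^sub>v x"
    using assms by (intro eq_vecI) auto
  then show ?thesis using assms by (simp add: quad_form_def cscalar_prod_self)
qed

text \<open>The quadratic form of \<open>F * mat_adjoint F\<close> at \<open>x\<close> is the
  squared norm of \<open>mat_adjoint F *\<^sub>v x\<close>, so the Loewner constraint bounds the
  operator norm of the adjoint, and the trace is the squared Frobenius norm.\<close>

lemma feasible_iff:
  "feasible N L P \<tau> F \<longleftrightarrow> F \<in> carrier_mat N L \<and> frob2 F \<le> P \<and>
     (\<forall>x \<in> carrier_vec N. vnorm2 (mat_adjoint F *\<^sub>v x) \<le> \<tau> * vnorm2 x)"
  unfolding feasible_def loewner_le_iff mat_trace_mult_adjoint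
  by (auto simp: hermitian_mult_adjoint quad_form_mult_adjoint hermitian_smult_one
      quad_form_smult_one less_eq_complex_def)

section \<open>Splitting off a block, and the spectral theorem\<close>

lemma diagonal_mat_mult_vec:
  fixes D :: "'a :: semiring_0 mat"
  assumes "D \<in> carrier_mat n m" "diagonal_mat D" "x \<in> carrier_vec m" "i < n" "i < m"
  shows "(D *\<^sub>v x) $ i = D $$ (i, i) * x $ i"
proof -
  have "(D *\<^sub>v x) $ i = (\<Sum>j\<in>{0..<m}. D $$ (i, j) * x $ j)"
    using assms by (simp add: scalar_prod_def)
  also have "\<dots> = (\<Sum>j\<in>{0..<m}. if j = i then D $$ (i, i) * x $ i else 0)"
    using assms by (intro sum.cong) (auto simp: diagonal_mat_def)
  finally show ?thesis using assms by simp
qed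

text \<open>In the bases \<open>U\<close> and \<open>V\<close> the relation for \<open>F\<close>
  clears the first column outside the corner, and the relation for the adjoint clears the first row.
  With \<open>U = V\<close> and a Hermitian matrix this also splits off an eigenvector.\<close>

lemma svd_deflate:
  fixes F :: "complex mat"
  assumes F: "F \<in> carrier_mat (Suc n) (Suc m)"
    and U: "unitary_mat (Suc n) U" "col U 0 = u" and V: "unitary_mat (Suc m) V" "col V 0 = v"
    and Fv: "F *\<^sub>v v = s \<cdot>\<^sub>v u" and Fu: "mat_adjoint F *\<^sub>v u = cnj s \<cdot>\<^sub>v v"
  shows "\<exists>F'. F' \<in> carrier_mat n m \<and> F = U * diag_ext s F' * mat_adjoint V"
proof -
  note u = unitary_matD[OF U(1)] and v = unitary_matD[OF V(1)]
  define B where "B = mat_adjoint U * F * V"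
  have B: "B \<in> carrier_mat (Suc n) (Suc m)" using F u v by (simp add: B_def)
  have ue: "U *\<^sub>v unit_vec (Suc n) 0 = u" using u U(2) by (simp add: mult_mat_unit_vec)
  have ve: "V *\<^sub>v unit_vec (Suc m) 0 = v" using v V(2) by (simp add: mult_mat_unit_vec)
  have uc: "u \<in> carrier_vec (Suc n)" using u(1) U(2) by (metis carrier_matD(1) col_dim)
  have vc: "v \<in> carrier_vec (Suc m)" using v(1) V(2) by (metis carrier_matD(1) col_dim)
  have "B *\<^sub>v unit_vec (Suc m) 0 = mat_adjoint U *\<^sub>v (F *\<^sub>v (V *\<^sub>v unit_vec (Suc m) 0))"
    unfolding B_def using F u(1) v(1) by (simp add: assoc_mult_mat_vec_dim)
  also have "\<dots> = s \<cdot>\<^sub>v unit_vec (Suc n) 0"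
    using u(1) uc unitary_mat_cancel_vec(1)[OF U(1), of "unit_vec (Suc n) 0"]
    by (simp add: ve Fv ue mult_mat_vec[of _ "Suc n" "Suc n"])
  finally have "col B 0 = s \<cdot>\<^sub>v unit_vec (Suc n) 0"
    using B by (simp add: mult_mat_unit_vec)
  then have c: "B $$ (i, 0) = (if i = 0 then s else 0)" if "i < Suc n" for i
    using that B by (metis col_def index_smult_vec(1) index_unit_vec(1,3) index_vec carrier_matD mult_zero_right mult.right_neutral zero_less_Suc)
  \<comment> \<open>The first row of \<open>B\<close> is obtained as the conjugate of the first
    column of its adjoint.\<close>
  have "mat_adjoint B = mat_adjoint V * (mat_adjoint F * U)"
    unfolding B_def using F u(1) v(1)
    by (simp add: mat_adjoint_mult_dim)
  then have "mat_adjoint B *\<^sub>v unit_vec (Suc n) 0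
      = mat_adjoint V *\<^sub>v (mat_adjoint F *\<^sub>v (U *\<^sub>v unit_vec (Suc n) 0))"
    using F u(1) v(1) by (simp add: assoc_mult_mat_vec_dim)
  also have "\<dots> = cnj s \<cdot>\<^sub>v unit_vec (Suc m) 0"
    using v(1) vc unitary_mat_cancel_vec(1)[OF V(1), of "unit_vec (Suc m) 0"]
    by (simp add: ve Fu ue mult_mat_vec[of _ "Suc m" "Suc m"])
  finally have cB: "col (mat_adjoint B) 0 = cnj s \<cdot>\<^sub>v unit_vec (Suc m) 0"
    using mult_mat_unit_vec[of "mat_adjoint B" "Suc m" "Suc n" 0] B by simp
  have "cnj (B $$ (0, j)) = (if j = 0 then cnj s else 0)" if "j < Suc m" for j
    using arg_cong[OF cB, of "\<lambda>w. w $ j"] that B by (simp add: if_distrib cong: if_cong split: if_splits)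
  then have r: "B $$ (0, j) = (if j = 0 then s else 0)" if "j < Suc m" for j
    using that by (metis complex_cnj_cnj complex_cnj_zero)
  define F' where "F' = mat n m (\<lambda>(i, j). B $$ (Suc i, Suc j))"
  have F': "F' \<in> carrier_mat n m" by (simp add: F'_def)
  have "B = diag_ext s F'"
    using B F' c r by (intro eq_mat_SucI[of _ n m]) (auto simp: F'_def)
  moreover have "F = U * B * mat_adjoint V"
  proof -
    have "U * B = F * V"
      unfolding B_def using F u(1) v(1) unitary_mat_cancel(2)[OF U(1), of "F * V" "Suc m"]
      by (simp add: assoc_mult_mat_dim)
    then show ?thesis using F v by (simp add: assoc_mult_mat_dim)
  qed
  ultimately show ?thesis using F' by blast
qed

lemma hermitian_eigenvalue_real:
  assumes "hermitian_mat n A" "x \<in> carrier_vec n" "x \<noteq> 0\<^sub>v n" "A *\<^sub>v x = k \<cdot>\<^sub>v x"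
  shows "k \<in> \<real>"
proof -
  have "complex_of_real (quad_form A x) = k * complex_of_real (vnorm2 x)"
    using hermitian_cscalar_prod[OF assms(1,2)] assms by (simp add: cscalar_prod_self)
  moreover have "vnorm2 x \<noteq> 0" using assms vnorm2_eq_0 by blast
  ultimately have "k = complex_of_real (quad_form A x / vnorm2 x)"
    by (simp add: field_simps)
  then show ?thesis by (metis Reals_of_real)
qed

lemma normalize_vec:
  assumes "x \<in> carrier_vec n" "x \<noteq> 0\<^sub>v n"
  shows "vnorm2 (complex_of_real (1 / sqrt (vnorm2 x)) \<cdot>\<^sub>v x) = 1"
proof -
  have "vnorm2 x > 0" using assms vnorm2_eq_0[of x n] vnorm2_nonneg[of x] by linarith
  then show ?thesis by (simp add: norm_divide power_divide)
qed

lemma evd_eigenvector: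
  fixes D :: "complex mat"
  assumes U: "unitary_mat n U" and D: "D \<in> carrier_mat n n" "diagonal_mat D" and i: "i < n"
  shows "(U * D * mat_adjoint U) *\<^sub>v col U i = D $$ (i, i) \<cdot>\<^sub>v col U i"
proof -
  note u = unitary_matD[OF U]
  have "(U * D * mat_adjoint U) *\<^sub>v col U i = U *\<^sub>v (D *\<^sub>v (mat_adjoint U *\<^sub>v (U *\<^sub>v unit_vec n i)))"
    using u(1) D(1) i by (simp add: assoc_mult_mat_vec_dim mult_mat_unit_vec)
  also have "\<dots> = U *\<^sub>v (D *\<^sub>v unit_vec n i)"
    using U by simp
  also have "D *\<^sub>v unit_vec n i = D $$ (i, i) \<cdot>\<^sub>v unit_vec n i"
    using D i by (intro eq_vecI) (auto simp: diagonal_mat_mult_vec[of D n n] simp del: index_mult_mat_vec)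
  also have "U *\<^sub>v \<dots> = D $$ (i, i) \<cdot>\<^sub>v col U i"
    using u(1) i by (simp add: mult_mat_vec[of _ n n] mult_mat_unit_vec)
  finally show ?thesis .
qed

text \<open>Absorbs a factorisation of the inner block into the outer unitary factors. This is the
  reassembly step of both inductions.\<close>

lemma diag_ext_unitary_mult:
  assumes U: "unitary_mat (Suc n) U" and V: "unitary_mat (Suc m) V"
    and U': "U' \<in> carrier_mat n n" and V': "V' \<in> carrier_mat m m" and D: "D \<in> carrier_mat n m"
  shows "U * diag_ext s (U' * D * mat_adjoint V') * mat_adjoint V
    = (U * diag_ext 1 U') * diag_ext s D * mat_adjoint (V * diag_ext 1 V')"
  using U' V' D unitary_matD(1)[OF U] unitary_matD(1)[OF V]
  by (simp add: mat_adjoint_mult_dim diag_ext_adjoint assoc_mult_mat_dim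
      flip: diag_ext_mult[of U' n n "D * mat_adjoint V'" m 1 s, simplified]
        diag_ext_mult[of D n m "mat_adjoint V'" m s 1, simplified])

lemma unitary_mat_cancel_both:
  assumes "unitary_mat n U" "unitary_mat m V" "B \<in> carrier_mat n m"
  shows "mat_adjoint U * (U * B * mat_adjoint V) * V = B"
  using assms unitary_mat_cancel(1)[OF assms(1), of B m] unitary_matD[OF assms(1)] unitary_matD[OF assms(2)]
  by (simp add: assoc_mult_mat_dim)

lemma hermitian_mat_diag_extD:
  assumes "hermitian_mat (Suc n) (diag_ext k A)"
  shows "hermitian_mat n A"
proof -
  have A: "A \<in> carrier_mat n n" using hermitian_matD(1)[OF assms] by simp
  have "diag_ext (cnj k) (mat_adjoint A) = diag_ext k A"
    using assms by (simp add: hermitian_mat_def diag_ext_adjoint)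
  then have "mat_adjoint A $$ (i, j) = A $$ (i, j)" if "i < n" "j < n" for i j
    using arg_cong[of _ _ "\<lambda>M. M $$ (Suc i, Suc j)"] that A
    by (metis carrier_matD diag_ext_index(4) mat_adjoint_carrier)
  then show ?thesis
    using A by (auto simp: hermitian_mat_def simp del: mat_adjoint_index intro!: eq_matI)
qed

lemma vnorm2_col_unitary:
  assumes "unitary_mat n U" "i < n"
  shows "vnorm2 (col U i) = 1" "col U i \<in> carrier_vec n"
proof -
  note u = unitary_matD(1)[OF assms(1)]
  show "vnorm2 (col U i) = 1"
    using vnorm2_unitary[OF assms(1), of "unit_vec n i"] assms u by (simp add: mult_mat_unit_vec)
  show "col U i \<in> carrier_vec n" using u by (metis carrier_matD(1) col_dim)
qed

text \<open>The columns of \<open>U * diag_ext 1 V\<close> are unit eigenvectors of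
  \<open>A\<close>, so every diagonal entry of \<open>D\<close> is an eigenvalue of \<open>A\<close>
  and is at most \<open>k\<close> by \<open>top\<close>. Putting \<open>k\<close> first therefore
  keeps the descending order.\<close>

lemma descending_evd_diag_ext:
  assumes U: "unitary_mat (Suc n) U" and VD: "descending_evd n A' V D" and k: "k \<in> \<real>"
    and A: "A = U * diag_ext k A' * mat_adjoint U"
    and top: "\<And>l x. x \<in> carrier_vec (Suc n) \<Longrightarrow> vnorm2 x = 1 \<Longrightarrow> A *\<^sub>v x = l \<cdot>\<^sub>v x \<Longrightarrow> Re l \<le> Re k"
  shows "descending_evd (Suc n) A (U * diag_ext 1 V) (diag_ext k D)"
proof -
  have V: "unitary_mat n V" and D: "D \<in> carrier_mat n n" "diagonal_mat D"
    and A'eq: "A' = V * D * mat_adjoint V"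
    and Dr: "\<And>i. i < n \<Longrightarrow> D $$ (i, i) \<in> \<real>"
    and Dd: "\<And>i j. i \<le> j \<Longrightarrow> j < n \<Longrightarrow> D $$ (j, j) \<le> D $$ (i, i)"
    using VD by (auto simp: descending_evd_def)
  define W where "W = U * diag_ext 1 V"
  have W: "unitary_mat (Suc n) W"
    unfolding W_def using U V by (intro unitary_mat_mult unitary_diag_ext)
  have D': "diag_ext k D \<in> carrier_mat (Suc n) (Suc n)" "diagonal_mat (diag_ext k D)"
    using D by (auto simp: diag_ext_diagonal)
  have Aeq: "A = W * diag_ext k D * mat_adjoint W"
    unfolding A A'eq W_def using unitary_matD(1)[OF V] D(1)
    by (intro diag_ext_unitary_mult[OF U U])
  have le: "D $$ (i, i) \<le> k" if "i < n" for i
  proof -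
    have "A *\<^sub>v col W (Suc i) = D $$ (i, i) \<cdot>\<^sub>v col W (Suc i)"
      using evd_eigenvector[OF W D', of "Suc i"] that D(1) Aeq by simp
    then have "Re (D $$ (i, i)) \<le> Re k"
      using top vnorm2_col_unitary[OF W, of "Suc i"] that by simp
    then show ?thesis using k Dr[OF that] by (auto simp: less_eq_complex_def complex_is_Real_iff)
  qed
  have "diag_ext k D $$ (i, i) \<in> \<real>" if "i < Suc n" for i
    using that D(1) Dr k by (cases i) auto
  moreover have "diag_ext k D $$ (j, j) \<le> diag_ext k D $$ (i, i)" if "i \<le> j" "j < Suc n" for i j
    using that D(1) Dd le by (cases i; cases j) auto
  ultimately show ?thesis
    using W D' Aeq unfolding descending_evd_def W_def[symmetric] by auto
qed

text \<open>Induction on the size: a unit eigenvector for the largest eigenvalue is split off, and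
  the remaining block is again Hermitian.\<close>

theorem hermitian_descending_evd:
  assumes "hermitian_mat n A"
  shows "\<exists>U D. descending_evd n A U D"
  using assms
proof (induction n arbitrary: A)
  case 0
  then have "descending_evd 0 A (1\<^sub>m 0) A"
    by (auto simp: descending_evd_def hermitian_mat_def unitary_mat_one diagonal_mat_def intro!: eq_matI)
  then show ?case by blast
next
  case (Suc n)
  note A = hermitian_matD[OF Suc.prems]
  have real: "k \<in> \<real>" if "k \<in> spectrum A" for k
    using that Suc.prems A(1) hermitian_eigenvalue_real
    unfolding spectrum_def eigenvalue_def eigenvector_def by auto
  have fin: "finite (Re ` spectrum A)" "Re ` spectrum A \<noteq> {}"
    using card_finite_spectrum(1)[OF A(1)] spectrum_non_empty[OF A(1)] by auto
  \<comment> \<open>The spectrum is a set of complex numbers, so the maximum is taken over real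
    parts; \<open>real\<close> makes this the largest eigenvalue.\<close>
  obtain k where "k \<in> spectrum A" "Re k = Max (Re ` spectrum A)"
    using Max_in[OF fin] by auto
  then have k: "k \<in> spectrum A" "\<And>l. l \<in> spectrum A \<Longrightarrow> Re l \<le> Re k"
    using Max_ge[OF fin(1)] by auto
  from k(1) obtain x where x: "x \<in> carrier_vec (Suc n)" "x \<noteq> 0\<^sub>v (Suc n)" "A *\<^sub>v x = k \<cdot>\<^sub>v x"
    using A(1) unfolding spectrum_def eigenvalue_def eigenvector_def by auto
  define u where "u = complex_of_real (1 / sqrt (vnorm2 x)) \<cdot>\<^sub>v x"
  have u: "u \<in> carrier_vec (Suc n)" "vnorm2 u = 1"
    using x normalize_vec[OF x(1,2)] by (auto simp: u_def)
  have Au: "A *\<^sub>v u = k \<cdot>\<^sub>v u"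
    using x A(1) by (simp add: u_def mult_mat_vec[of _ "Suc n" "Suc n"] smult_smult_assoc mult.commute)
  have ck: "cnj k = k" using real[OF k(1)] by (simp add: Reals_cnj_iff)
  obtain U where U: "unitary_mat (Suc n) U" "col U 0 = u"
    using unitary_mat_with_first_col[OF u] by blast
  note uu = unitary_matD[OF U(1)]
  \<comment> \<open>Since \<open>A\<close> is self-adjoint and \<open>k\<close> is real, the
    eigenvector equation serves as both relations of \<open>svd_deflate\<close>.\<close>
  obtain A' where A': "A' \<in> carrier_mat n n" "A = U * diag_ext k A' * mat_adjoint U"
    using svd_deflate[OF A(1) U U Au] Au ck A(2) by auto
  have "mat_adjoint U * A * U = diag_ext k A'"
    unfolding A'(2) using A'(1) U by (intro unitary_mat_cancel_both) auto
  then have "hermitian_mat n A'"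
    using hermitian_congruence[OF Suc.prems uu(1)] hermitian_mat_diag_extD by simp
  then obtain V D where VD: "descending_evd n A' V D" using Suc.IH by blast
  have "Re l \<le> Re k"
    if "x \<in> carrier_vec (Suc n)" "vnorm2 x = 1" "A *\<^sub>v x = l \<cdot>\<^sub>v x" for l x
  proof -
    have "x \<noteq> 0\<^sub>v (Suc n)" using that by auto
    then have "l \<in> spectrum A"
      using that A(1) unfolding spectrum_def eigenvalue_def eigenvector_def by auto
    then show ?thesis by (rule k)
  qed
  then show ?case
    using descending_evd_diag_ext[OF U(1) VD real[OF k(1)] A'(2)] by blast
qed

section \<open>Extremal properties of eigenvalues\<close>

lemma vnorm2_sum: "x \<in> carrier_vec n \<Longrightarrow> vnorm2 x = (\<Sum>i<n. (cmod (x $ i))\<^sup>2)"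
  by (simp add: vnorm2_def)

text \<open>Applied twice: with \<tau> as the coefficient to detect equality in a norm bound, and
  with an inner product as the coefficient to compute the norm of a projection.\<close>

lemma vnorm2_diff_smult:
  assumes "a \<in> carrier_vec n" "v \<in> carrier_vec n"
  shows "vnorm2 (a - c \<cdot>\<^sub>v v) = vnorm2 a - 2 * Re (cnj c * (a \<bullet>c v)) + (cmod c)\<^sup>2 * vnorm2 v"
proof -
  have "(cmod (z - c * w))\<^sup>2 = (cmod z)\<^sup>2 - 2 * Re (cnj c * (z * cnj w)) + (cmod c)\<^sup>2 * (cmod w)\<^sup>2"
    for z w
    unfolding cmod_power2 by (simp add: power2_eq_square algebra_simps)
  then have "vnorm2 (a - c \<cdot>\<^sub>v v) = (\<Sum>i<n. (cmod (a $ i))\<^sup>2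
      - 2 * Re (cnj c * (a $ i * cnj (v $ i))) + (cmod c)\<^sup>2 * (cmod (v $ i))\<^sup>2)"
    using assms by (simp add: vnorm2_def)
  also have "\<dots> = vnorm2 a - 2 * Re (cnj c * (\<Sum>i<n. a $ i * cnj (v $ i))) + (cmod c)\<^sup>2 * vnorm2 v"
    using assms by (simp only: vnorm2_sum sum.distrib sum_subtractf sum_distrib_left Re_sum)
  also have "(\<Sum>i<n. a $ i * cnj (v $ i)) = a \<bullet>c v"
    using assms by (auto simp: scalar_prod_def atLeast0LessThan)
  finally show ?thesis .
qed

section \<open>Rayleigh bounds and norm bounds\<close>

lemma quad_form_evd:
  assumes U: "unitary_mat n U" and D: "D \<in> carrier_mat n n" "diagonal_mat D" and x: "x \<in> carrier_vec n"
  shows "quad_form (U * D * mat_adjoint U) x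
    = (\<Sum>i<n. Re (D $$ (i, i)) * (cmod ((mat_adjoint U *\<^sub>v x) $ i))\<^sup>2)"
proof -
  define y where "y = mat_adjoint U *\<^sub>v x"
  have u: "U \<in> carrier_mat n n" using U by (rule unitary_matD)
  then have y: "y \<in> carrier_vec n" using x by (simp add: y_def)
  have "(U * D * mat_adjoint U) *\<^sub>v x = U *\<^sub>v (D *\<^sub>v y)"
    using u D x by (simp add: assoc_mult_mat_vec_dim y_def)
  then have "(U * D * mat_adjoint U *\<^sub>v x) \<bullet>c x = (D *\<^sub>v y) \<bullet>c y"
    using cscalar_prod_mult_mat_vec[of U n n "D *\<^sub>v y" x] u D x y by (simp add: y_def)
  also have "\<dots> = (\<Sum>i<n. (D *\<^sub>v y) $ i * cnj (y $ i))"
    using D y by (auto simp: scalar_prod_def atLeast0LessThan)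
  also have "\<dots> = (\<Sum>i<n. D $$ (i, i) * complex_of_real ((cmod (y $ i))\<^sup>2))"
    using D y
    by (intro sum.cong)
       (simp_all add: diagonal_mat_mult_vec[of D n n] complex_norm_square mult.assoc
          del: index_mult_mat_vec of_real_power)
  finally show ?thesis by (simp add: quad_form_def y_def)
qed

lemma descending_evdD:
  assumes "descending_evd n A U D"
  shows "unitary_mat n U" "D \<in> carrier_mat n n" "diagonal_mat D" "A = U * D * mat_adjoint U"
    and "\<And>i. i < n \<Longrightarrow> complex_of_real (Re (D $$ (i, i))) = D $$ (i, i)"
    and "\<And>i j. i \<le> j \<Longrightarrow> j < n \<Longrightarrow> Re (D $$ (j, j)) \<le> Re (D $$ (i, i))"
  using assms by (auto simp: descending_evd_def less_eq_complex_def)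

text \<open>In eigencoordinates the form weights the diagonal entries by squared moduli that sum to
  \<open>vnorm2 x\<close>, and entry 0 is the largest.\<close>

lemma evd_quad_form_le:
  assumes evd: "descending_evd n A U D" and x: "x \<in> carrier_vec n" and n: "0 < n"
  shows "quad_form A x \<le> Re (D $$ (0, 0)) * vnorm2 x"
proof -
  note d = descending_evdD[OF evd]
  have "vnorm2 x = vnorm2 (mat_adjoint U *\<^sub>v x)"
    using vnorm2_unitary[OF unitary_mat_adjoint[OF d(1)] x] by simp
  then have *: "vnorm2 x = (\<Sum>i<n. (cmod ((mat_adjoint U *\<^sub>v x) $ i))\<^sup>2)"
    using unitary_matD(1)[OF d(1)] vnorm2_sum[of "mat_adjoint U *\<^sub>v x" n] by simp
  show ?thesis
    unfolding d(4) quad_form_evd[OF d(1-3) x] * sum_distrib_left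
    using d(6) by (intro sum_mono mult_right_mono) auto
qed

text \<open>Equality makes a sum of nonnegative terms vanish, so \<open>x\<close> has no component
  along eigenvectors with an eigenvalue below the top one.\<close>

lemma evd_quad_form_eq:
  assumes evd: "descending_evd n A U D" and x: "x \<in> carrier_vec n" and n: "0 < n"
    and eq: "quad_form A x = Re (D $$ (0, 0)) * vnorm2 x"
  shows "A *\<^sub>v x = D $$ (0, 0) \<cdot>\<^sub>v x"
proof -
  note d = descending_evdD[OF evd]
  have u: "U \<in> carrier_mat n n" using d(1) by (rule unitary_matD)
  define y where "y = mat_adjoint U *\<^sub>v x"
  have y: "y \<in> carrier_vec n" using u by (simp add: y_def)
  have "vnorm2 x = vnorm2 y"
    using vnorm2_unitary[OF unitary_mat_adjoint[OF d(1)] x] by (simp add: y_def)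
  also have "\<dots> = (\<Sum>i<n. (cmod (y $ i))\<^sup>2)" using y by (rule vnorm2_sum)
  finally have "(\<Sum>i<n. (Re (D $$ (0, 0)) - Re (D $$ (i, i))) * (cmod (y $ i))\<^sup>2) = 0"
    using eq quad_form_evd[OF d(1-3) x]
    by (simp add: d(4)[symmetric] y_def left_diff_distrib sum_subtractf sum_distrib_left)
  then have z: "(Re (D $$ (0, 0)) - Re (D $$ (i, i))) * (cmod (y $ i))\<^sup>2 = 0" if "i < n" for i
    using that d(6) by (subst (asm) sum_nonneg_eq_0_iff) auto
  have "D $$ (i, i) * y $ i = D $$ (0, 0) * y $ i" if "i < n" for i
    using z[OF that] d(5)[OF that] d(5)[OF n] by (metis mult_eq_0_iff diff_eq_diff_eq cancel_comm_monoid_add_class.diff_cancel mult_zero_right norm_eq_zero zero_eq_power2)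
  then have "D *\<^sub>v y = D $$ (0, 0) \<cdot>\<^sub>v y"
    using d(2,3) y by (intro eq_vecI) (auto simp: diagonal_mat_mult_vec[of D n n] simp del: index_mult_mat_vec)
  then have "U *\<^sub>v (D *\<^sub>v y) = D $$ (0, 0) \<cdot>\<^sub>v (U *\<^sub>v y)"
    using u y by (simp add: mult_mat_vec[of _ n n])
  moreover have "U *\<^sub>v y = x" using d(1) x by (simp add: y_def)
  ultimately show ?thesis
    unfolding d(4) using u d(2) x by (simp add: assoc_mult_mat_vec_dim y_def)
qed

text \<open>With \<open>w\<close> the image of \<open>v\<close> under F^H F, the squared norm of w -
  \<tau> v is at most \<tau> (\<tau> |v|^2 - |F v|^2). Its nonnegativity gives the bound, and
  equality in the bound forces w = \<tau> v.\<close>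

lemma contraction_adjoint:
  assumes F: "F \<in> carrier_mat n m" and \<tau>: "\<tau> > 0"
    and le: "\<And>x. x \<in> carrier_vec n \<Longrightarrow> vnorm2 (mat_adjoint F *\<^sub>v x) \<le> \<tau> * vnorm2 x"
    and v: "v \<in> carrier_vec m"
  shows "vnorm2 (F *\<^sub>v v) \<le> \<tau> * vnorm2 v"
    and "vnorm2 (F *\<^sub>v v) = \<tau> * vnorm2 v \<Longrightarrow>
      mat_adjoint F *\<^sub>v (F *\<^sub>v v) = complex_of_real \<tau> \<cdot>\<^sub>v v"
proof -
  define w where "w = mat_adjoint F *\<^sub>v (F *\<^sub>v v)"
  have w: "w \<in> carrier_vec m" using F by (simp add: w_def)
  have "w \<bullet>c v = complex_of_real (vnorm2 (F *\<^sub>v v))"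
    using cscalar_prod_mult_mat_vec[of "mat_adjoint F" m n "F *\<^sub>v v" v] F v
    by (simp add: w_def cscalar_prod_self)
  then have "vnorm2 (w - complex_of_real \<tau> \<cdot>\<^sub>v v) = vnorm2 w - 2 * \<tau> * vnorm2 (F *\<^sub>v v) + \<tau>\<^sup>2 * vnorm2 v"
    using vnorm2_diff_smult[OF w v, of "complex_of_real \<tau>"] by simp
  moreover have "vnorm2 w \<le> \<tau> * vnorm2 (F *\<^sub>v v)"
    unfolding w_def using F by (intro le) simp
  ultimately have *: "vnorm2 (w - complex_of_real \<tau> \<cdot>\<^sub>v v) \<le> \<tau> * (\<tau> * vnorm2 v - vnorm2 (F *\<^sub>v v))"
    by (simp add: power2_eq_square algebra_simps)
  then have "0 \<le> \<tau> * (\<tau> * vnorm2 v - vnorm2 (F *\<^sub>v v))"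
    using vnorm2_nonneg order_trans by blast
  then show "vnorm2 (F *\<^sub>v v) \<le> \<tau> * vnorm2 v"
    using \<tau> by (simp add: zero_le_mult_iff)
  assume "vnorm2 (F *\<^sub>v v) = \<tau> * vnorm2 v"
  then have "vnorm2 (w - complex_of_real \<tau> \<cdot>\<^sub>v v) = 0"
    using * vnorm2_nonneg[of "w - complex_of_real \<tau> \<cdot>\<^sub>v v"] by simp
  moreover have "w - complex_of_real \<tau> \<cdot>\<^sub>v v \<in> carrier_vec m" using w v by simp
  ultimately have z: "w - complex_of_real \<tau> \<cdot>\<^sub>v v = 0\<^sub>v m" using vnorm2_eq_0 by blast
  show "mat_adjoint F *\<^sub>v (F *\<^sub>v v) = complex_of_real \<tau> \<cdot>\<^sub>v v"
    unfolding w_def[symmetric]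
  proof (rule eq_vecI)
    fix i assume "i < dim_vec (complex_of_real \<tau> \<cdot>\<^sub>v v)"
    then show "w $ i = (complex_of_real \<tau> \<cdot>\<^sub>v v) $ i"
      using arg_cong[OF z, of "\<lambda>x. x $ i"] w v by simp
  qed (use w v in simp)
qed

section \<open>Interlacing for compressions\<close>

lemma cscalar_mult_mat_vec_sum:
  fixes B :: "complex mat"
  assumes "B \<in> carrier_mat n m" "w \<in> carrier_vec m" "x \<in> carrier_vec n"
  shows "(B *\<^sub>v w) \<bullet>c x = (\<Sum>i<n. \<Sum>j<m. B $$ (i, j) * w $ j * cnj (x $ i))"
  using assms by (auto simp: scalar_prod_def sum_distrib_right atLeast0LessThan intro!: sum.cong)

text \<open>A Cauchy interlacing inequality: \<open>w\<close> is chosen supported on the indices \<open>\<ge> i\<close> with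
  \<open>Z w\<close> supported on the indices \<open>\<le> i\<close>, which leaves one more unknown than equations.\<close>

lemma compression_eigenvalue_ge:
  assumes Z: "unitary_mat n Z" and E: "E \<in> carrier_mat n n" "diagonal_mat E"
    and Ed: "\<And>i j. i \<le> j \<Longrightarrow> j < n \<Longrightarrow> Re (E $$ (j, j)) \<le> Re (E $$ (i, i))"
    and B: "B = mat_adjoint Z * E * Z"
    and Bo: "\<And>i j. 1 \<le> i \<Longrightarrow> i < n \<Longrightarrow> 1 \<le> j \<Longrightarrow> j < n \<Longrightarrow> i \<noteq> j \<Longrightarrow> B $$ (i, j) = 0"
    and Bd: "\<And>i j. 1 \<le> i \<Longrightarrow> i \<le> j \<Longrightarrow> j < n \<Longrightarrow> Re (B $$ (j, j)) \<le> Re (B $$ (i, i))"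
    and i: "1 \<le> i" "i < n"
  shows "Re (E $$ (i, i)) \<le> Re (B $$ (i, i))"
proof -
  note z = unitary_matD[OF Z]
  have Bc: "B \<in> carrier_mat n n" using B z by simp
  \<comment> \<open>For \<open>k < i\<close> the condition says \<open>w $ k = 0\<close>, for
    \<open>k > i\<close> it says that entry \<open>k\<close> of \<open>Z *\<^sub>v w\<close> is
    zero. Row \<open>i\<close> of \<open>R\<close> is filled with zeros, so \<open>R\<close> is
    singular and a nonzero \<open>w\<close> exists.\<close>
  define r where "r k = (if k < i then unit_vec n k else row Z k)" for k
  define R where "R = mat\<^sub>r n n (\<lambda>k. if k = i then 0\<^sub>v n else r k)"
  have R: "R \<in> carrier_mat n n" by (simp add: R_def)
  have "det R = 0"
    unfolding R_def using i z by (intro det_row_0) (auto simp: r_def)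
  then obtain w where w: "w \<in> carrier_vec n" "w \<noteq> 0\<^sub>v n" "R *\<^sub>v w = 0\<^sub>v n"
    using det_0_iff_vec_prod_zero[OF R] by auto
  have rw: "r k \<bullet> w = 0" if "k < n" "k \<noteq> i" for k
  proof -
    have "row R k = r k"
      using that z unfolding R_def by (intro row_mat_of_row_fun[THEN trans]) (auto simp: r_def)
    then show ?thesis using arg_cong[OF w(3), of "\<lambda>x. x $ k"] that R by simp
  qed
  have w0: "w $ k = 0" if "k < i" for k
    using rw[of k] that i w(1) by (simp add: r_def)
  define y where "y = Z *\<^sub>v w"
  have y: "y \<in> carrier_vec n" using z by (simp add: y_def)
  have y0: "y $ k = 0" if "i < k" "k < n" for k
    using rw[of k] that z by (simp add: r_def y_def)
  have ny: "vnorm2 y = vnorm2 w" unfolding y_def using Z w(1) by (rule vnorm2_unitary)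
  have "Re (E $$ (i, i)) * vnorm2 w = (\<Sum>k<n. Re (E $$ (i, i)) * (cmod (y $ k))\<^sup>2)"
    using y by (simp add: ny[symmetric] vnorm2_sum sum_distrib_left)
  also have "\<dots> \<le> (\<Sum>k<n. Re (E $$ (k, k)) * (cmod (y $ k))\<^sup>2)"
  proof (rule sum_mono)
    fix k assume "k \<in> {..<n}"
    then show "Re (E $$ (i, i)) * (cmod (y $ k))\<^sup>2 \<le> Re (E $$ (k, k)) * (cmod (y $ k))\<^sup>2"
      using y0[of k] Ed[of k i] i by (cases "k \<le> i") (auto intro: mult_right_mono)
  qed
  \<comment> \<open>Viewing \<open>E\<close> as its own decomposition with the identity matrix makes
    \<open>quad_form_evd\<close> applicable.\<close>
  also have "\<dots> = quad_form (1\<^sub>m n * E * mat_adjoint (1\<^sub>m n)) y"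
    using E y by (subst quad_form_evd[OF unitary_mat_one]) auto
  also have "\<dots> = quad_form B w"
    unfolding B using quad_form_congruence[OF E(1) z(1) w(1)] E(1) by (simp add: y_def)
  also have "\<dots> = (\<Sum>a<n. \<Sum>b<n. Re (B $$ (a, b) * w $ b * cnj (w $ a)))"
    unfolding quad_form_def using cscalar_mult_mat_vec_sum[OF Bc w(1) w(1)] by simp
  also have "\<dots> = (\<Sum>a<n. \<Sum>b<n. if b = a then Re (B $$ (a, a)) * (cmod (w $ a))\<^sup>2 else 0)"
  proof (intro sum.cong refl)
    fix a b assume ab: "a \<in> {..<n}" "b \<in> {..<n}"
    have "w $ a * cnj (w $ a) = complex_of_real ((cmod (w $ a))\<^sup>2)"
      by (simp add: complex_norm_square del: of_real_power)
    then have "Re (B $$ (a, a) * w $ a * cnj (w $ a)) = Re (B $$ (a, a)) * (cmod (w $ a))\<^sup>2"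
      by (simp only: mult.assoc) simp
    \<comment> \<open>Row and column 0 of \<open>B\<close> may be full, but they meet only
      \<open>w $ 0\<close>, which is zero because \<open>1 \<le> i\<close>.\<close>
    moreover have "B $$ (a, b) * w $ b * cnj (w $ a) = 0" if "a \<noteq> b"
      using that w0[of a] w0[of b] Bo[of a b] ab i by (cases "a < i \<or> b < i") auto
    ultimately show "Re (B $$ (a, b) * w $ b * cnj (w $ a))
        = (if b = a then Re (B $$ (a, a)) * (cmod (w $ a))\<^sup>2 else 0)"
      by (cases "a = b") auto
  qed
  also have "\<dots> = (\<Sum>a<n. Re (B $$ (a, a)) * (cmod (w $ a))\<^sup>2)"
    by simp
  also have "\<dots> \<le> (\<Sum>a<n. Re (B $$ (i, i)) * (cmod (w $ a))\<^sup>2)"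
  proof (rule sum_mono)
    fix k assume "k \<in> {..<n}"
    then show "Re (B $$ (k, k)) * (cmod (w $ k))\<^sup>2 \<le> Re (B $$ (i, i)) * (cmod (w $ k))\<^sup>2"
      using w0[of k] Bd[of i k] i by (cases "i \<le> k") (auto intro: mult_right_mono)
  qed
  also have "\<dots> = Re (B $$ (i, i)) * vnorm2 w"
    using w(1) by (simp add: vnorm2_sum sum_distrib_left)
  finally have "Re (E $$ (i, i)) * vnorm2 w \<le> Re (B $$ (i, i)) * vnorm2 w" .
  moreover have "vnorm2 w > 0"
    using w vnorm2_eq_0[of w n] vnorm2_nonneg[of w] by linarith
  ultimately show ?thesis by simp
qed

lemma mat_trace_mult_commute:
  assumes "A \<in> carrier_mat n m" "B \<in> carrier_mat m n"
  shows "mat_trace (A * B) = mat_trace (B * A)"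
proof -
  have "mat_trace (A * B) = (\<Sum>i<n. \<Sum>j<m. A $$ (i, j) * B $$ (j, i))"
    using assms by (auto simp: mat_trace_def scalar_prod_def atLeast0LessThan intro!: sum.cong)
  also have "\<dots> = (\<Sum>j<m. \<Sum>i<n. A $$ (i, j) * B $$ (j, i))" by (rule sum.swap)
  also have "\<dots> = mat_trace (B * A)"
    using assms by (auto simp: mat_trace_def scalar_prod_def atLeast0LessThan mult.commute intro!: sum.cong)
  finally show ?thesis .
qed

lemma mat_trace_unitary:
  assumes "unitary_mat n Z" "A \<in> carrier_mat n n"
  shows "mat_trace (mat_adjoint Z * A * Z) = mat_trace A"
proof -
  note z = unitary_matD[OF assms(1)]
  have "mat_trace (mat_adjoint Z * (A * Z)) = mat_trace (A * Z * mat_adjoint Z)"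
    using z assms by (intro mat_trace_mult_commute[of _ n n]) auto
  then show ?thesis using z assms by (simp add: assoc_mult_mat_dim)
qed

text \<open>Complete \<open>v\<close> to an orthonormal basis and diagonalise the compression of
  \<open>M\<close> to the orthogonal complement of \<open>v\<close>. The rotation
  \<open>diag_ext 1 V\<close> does not touch column 0. Row and column 0 of the result stay
  unrestricted, hence the indices from 1 on.\<close>

lemma compression_evd:
  assumes M: "hermitian_mat (Suc m) M" and v: "v \<in> carrier_vec (Suc m)" "vnorm2 v = 1"
  shows "\<exists>Y. unitary_mat (Suc m) Y \<and> col Y 0 = v \<and>
    (\<forall>i j. 1 \<le> i \<longrightarrow> i < Suc m \<longrightarrow> 1 \<le> j \<longrightarrow> j < Suc m \<longrightarrow> i \<noteq> j \<longrightarrow>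
       (mat_adjoint Y * M * Y) $$ (i, j) = 0) \<and>
    (\<forall>i j. 1 \<le> i \<longrightarrow> i \<le> j \<longrightarrow> j < Suc m \<longrightarrow>
       Re ((mat_adjoint Y * M * Y) $$ (j, j)) \<le> Re ((mat_adjoint Y * M * Y) $$ (i, i)))"
proof -
  obtain Y1 where Y1: "unitary_mat (Suc m) Y1" "col Y1 0 = v"
    using unitary_mat_with_first_col[OF v] by blast
  note y1 = unitary_matD[OF Y1(1)] and Mc = hermitian_matD[OF M]
  define B1 where "B1 = mat_adjoint Y1 * M * Y1"
  have B1: "hermitian_mat (Suc m) B1"
    unfolding B1_def using M y1(1) by (rule hermitian_congruence)
  note b1 = hermitian_matD[OF B1]
  define C where "C = mat m m (\<lambda>(i, j). B1 $$ (Suc i, Suc j))"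
  have Cc: "C \<in> carrier_mat m m" by (simp add: C_def)
  have "cnj (B1 $$ (Suc j, Suc i)) = B1 $$ (Suc i, Suc j)" if "i < m" "j < m" for i j
    using that mat_adjoint_index[of "Suc i" B1 "Suc j"] b1 by simp
  then have "hermitian_mat m C"
    using Cc by (auto simp: hermitian_mat_def C_def intro!: eq_matI)
  then obtain V D where "descending_evd m C V D" using hermitian_descending_evd by blast
  note d = descending_evdD[OF this]
  note vv = unitary_matD[OF d(1)]
  define Y where "Y = Y1 * diag_ext 1 V"
  have Y: "unitary_mat (Suc m) Y"
    unfolding Y_def using Y1(1) unitary_diag_ext[OF d(1)] by (rule unitary_mat_mult)
  have "diag_ext 1 V *\<^sub>v unit_vec (Suc m) 0 = unit_vec (Suc m) 0"
    using vv(1) by (intro eq_vecI) (auto simp: diag_ext_def)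
  then have "Y *\<^sub>v unit_vec (Suc m) 0 = Y1 *\<^sub>v unit_vec (Suc m) 0"
    unfolding Y_def using y1(1) vv(1) by (simp add: assoc_mult_mat_vec_dim)
  also have "\<dots> = v" using y1(1) Y1(2) by (simp add: mult_mat_unit_vec)
  finally have "Y *\<^sub>v unit_vec (Suc m) 0 = v" .
  then have cY: "col Y 0 = v"
    using mult_mat_unit_vec[OF unitary_matD(1)[OF Y], of 0] by simp
  have ent: "(mat_adjoint Y * M * Y) $$ (Suc i, Suc j) = D $$ (i, j)" if ij: "i < m" "j < m" for i j
  proof -
    have "mat_adjoint Y * M * Y = mat_adjoint (diag_ext 1 V) * (B1 * diag_ext 1 V)"
      unfolding Y_def B1_def using y1(1) vv(1) Mc(1)
      by (simp add: mat_adjoint_mult_dim assoc_mult_mat_dim)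
    also have "\<dots> $$ (Suc i, Suc j) = (mat_adjoint V * (C * V)) $$ (i, j)"
      using ij vv(1) b1(1) Cc
      by (simp add: diag_ext_adjoint scalar_prod_def C_def del: sum.op_ivl_Suc)
         (simp add: sum.atLeast0_lessThan_Suc_shift del: sum.op_ivl_Suc)
    also have "mat_adjoint V * (C * V) = D"
      unfolding d(4) using vv d(1,2) unitary_mat_cancel(1)[OF d(1), of D m]
      by (simp add: assoc_mult_mat_dim)
    finally show ?thesis .
  qed
  have "(mat_adjoint Y * M * Y) $$ (i, j) = 0"
    if "1 \<le> i" "i < Suc m" "1 \<le> j" "j < Suc m" "i \<noteq> j" for i j
    using that ent[of "i - 1" "j - 1"] d(2,3) by (cases i; cases j) (auto simp: diagonal_mat_def)
  moreover have "Re ((mat_adjoint Y * M * Y) $$ (j, j)) \<le> Re ((mat_adjoint Y * M * Y) $$ (i, i))"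
    if "1 \<le> i" "i \<le> j" "j < Suc m" for i j
    using that ent[of "i - 1" "i - 1"] ent[of "j - 1" "j - 1"] d(6)[of "i - 1" "j - 1"]
    by (cases i; cases j) auto
  ultimately show ?thesis using Y cY by blast
qed

section \<open>Reallocating power in a Pareto optimal solution\<close>

lemma row_mat_adjoint: "i < dim_col A \<Longrightarrow> row (mat_adjoint A) i = conjugate (col A i)"
  for A :: "complex mat"
  by (intro eq_vecI) auto

lemma mat_adjoint_mult_vec_index:
  fixes A :: "complex mat"
  assumes "A \<in> carrier_mat n m" "x \<in> carrier_vec n" "j < m"
  shows "(mat_adjoint A *\<^sub>v x) $ j = x \<bullet>c col A j"
proof -
  have "(mat_adjoint A *\<^sub>v x) $ j = conjugate (col A j) \<bullet> x"
    using assms by (simp add: row_mat_adjoint)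
  also have "\<dots> = x \<bullet>c col A j"
    using assms by (intro comm_scalar_prod[of _ n]) auto
  finally show ?thesis .
qed

text \<open>Expresses the entries of an objective through pairs of columns, so that the effect of
  replacing or rescaling single columns can be read off.\<close>

lemma congruence_index:
  fixes A B :: "complex mat"
  assumes "A \<in> carrier_mat n n" "B \<in> carrier_mat n m" "i < m" "j < m"
  shows "(mat_adjoint B * A * B) $$ (i, j) = (A *\<^sub>v col B j) \<bullet>c col B i"
proof -
  have "mat_adjoint B * A * B = mat_adjoint B * (A * B)"
    using assms by (simp add: assoc_mult_mat_dim)
  also have "\<dots> $$ (i, j) = conjugate (col B i) \<bullet> (A *\<^sub>v col B j)"
    using assms by (simp add: row_mat_adjoint col_mult2 del: col_mult)
  also have "\<dots> = (A *\<^sub>v col B j) \<bullet>c col B i"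
    using assms by (intro comm_scalar_prod[of _ n]) auto
  finally show ?thesis .
qed

lemma pareto_optimalD:
  assumes Q: "hermitian_mat N Q" and F: "pareto_optimal N L P \<tau> Q F" and F': "feasible N L P \<tau> F'"
    and le: "\<And>x. x \<in> carrier_vec L \<Longrightarrow> quad_form (objective Q F) x \<le> quad_form (objective Q F') x"
  shows "objective Q F' = objective Q F"
proof -
  have "F \<in> carrier_mat N L" "F' \<in> carrier_mat N L"
    using F F' by (auto simp: pareto_optimal_def feasible_def)
  then have "loewner_le L (objective Q F) (objective Q F')"
    using Q le by (auto simp: loewner_le_iff objective_def hermitian_congruence)
  then show ?thesis using F F' by (auto simp: pareto_optimal_def)
qed

lemma frob2_mult_unitary:
  assumes "unitary_mat m X" "G \<in> carrier_mat n m"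
  shows "frob2 (G * mat_adjoint X) = frob2 G"
proof -
  have "G * mat_adjoint X * mat_adjoint (G * mat_adjoint X) = G * mat_adjoint G"
    using assms unitary_matD(1)[OF assms(1)] unitary_matD(2)[OF assms(1)]
      unitary_mat_cancel(1)[OF assms(1), of "mat_adjoint G" n]
    by (simp add: mat_adjoint_mult_dim assoc_mult_mat_dim)
  then have "mat_trace (G * mat_adjoint X * mat_adjoint (G * mat_adjoint X)) = mat_trace (G * mat_adjoint G)"
    by simp
  then show ?thesis unfolding mat_trace_mult_adjoint by simp
qed

text \<open>Both constraints depend only on the product of \<open>G\<close> with its adjoint, in
  which \<open>X\<close> cancels.\<close>

lemma feasible_mult_unitary:
  assumes X: "unitary_mat L X" and G: "G \<in> carrier_mat N L"
  shows "feasible N L P \<tau> (G * mat_adjoint X) \<longleftrightarrow> feasible N L P \<tau> G"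
proof -
  note xx = unitary_matD[OF X]
  have "vnorm2 (mat_adjoint (G * mat_adjoint X) *\<^sub>v x) = vnorm2 (mat_adjoint G *\<^sub>v x)"
    if "x \<in> carrier_vec N" for x
    using that G xx vnorm2_unitary[OF X, of "mat_adjoint G *\<^sub>v x"]
    by (simp add: mat_adjoint_mult_dim assoc_mult_mat_vec_dim)
  then show ?thesis
    using G xx(1) by (auto simp: feasible_iff frob2_mult_unitary[OF X G])
qed

text \<open>The competing point replaces column \<open>0\<close> of \<open>F Y\<close> by \<open>s u\<close>, shrinks the other columns by
  the factors \<open>c j\<close> and rotates the result back by \<open>X\<close>.\<close>

lemma pareto_reallocation_bound:
  assumes Q: "hermitian_mat N Q" and par: "pareto_optimal N (Suc m) P \<tau> Q F"
    and u: "u \<in> carrier_vec N" "vnorm2 u = 1" "Q *\<^sub>v u = complex_of_real k \<cdot>\<^sub>v u"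
    and X: "unitary_mat (Suc m) X" and E: "E \<in> carrier_mat (Suc m) (Suc m)" "diagonal_mat E"
    and obj: "objective Q F = X * E * mat_adjoint X"
    and Y: "unitary_mat (Suc m) Y" and Fu: "mat_adjoint F *\<^sub>v u = \<alpha> \<cdot>\<^sub>v col Y 0"
    and B: "B = mat_adjoint Y * objective Q F * Y"
    and Bo: "\<And>i j. 1 \<le> i \<Longrightarrow> i < Suc m \<Longrightarrow> 1 \<le> j \<Longrightarrow> j < Suc m \<Longrightarrow> i \<noteq> j \<Longrightarrow> B $$ (i, j) = 0"
    and c: "\<And>j. j < m \<Longrightarrow> 0 \<le> c j \<and> c j \<le> 1"
      "\<And>j. j < m \<Longrightarrow> (c j)\<^sup>2 * Re (B $$ (Suc j, Suc j)) = Re (E $$ (Suc j, Suc j))"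
    and s: "s\<^sup>2 \<le> \<tau>" "s\<^sup>2 + (\<Sum>j<m. (c j)\<^sup>2 * vnorm2 (F *\<^sub>v col Y (Suc j))) \<le> P"
  shows "k * s\<^sup>2 \<le> Re (E $$ (0, 0))"
proof (rule ccontr)
  assume neg: "\<not> k * s\<^sup>2 \<le> Re (E $$ (0, 0))"
  have feas: "feasible N (Suc m) P \<tau> F" using par by (simp add: pareto_optimal_def)
  then have F: "F \<in> carrier_mat N (Suc m)" by (simp add: feasible_def)
  note q = hermitian_matD[OF Q] and xx = unitary_matD[OF X] and yy = unitary_matD[OF Y]
  define G where "G = F * Y"
  have G: "G \<in> carrier_mat N (Suc m)" using F yy by (simp add: G_def)
  have cG: "col G j = F *\<^sub>v col Y j" if "j < Suc m" for j
    using that F yy(1) unfolding G_def by (intro col_mult2)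
  have cGc: "col G j \<in> carrier_vec N" for j using G by (metis carrier_matD(1) col_dim)
  have BG: "B = mat_adjoint G * Q * G"
    unfolding B G_def objective_def using F yy(1) q(1)
    by (simp add: mat_adjoint_mult_dim assoc_mult_mat_dim)
  \<comment> \<open>As \<open>mat_adjoint F *\<^sub>v u\<close> is parallel to column 0 of
    \<open>Y\<close>, it is orthogonal to the other columns of \<open>Y\<close>; moving
    \<open>F\<close> across gives the claim.\<close>
  have orth: "u \<bullet>c col G (Suc j) = 0" if "j < m" for j
  proof -
    have "mat_adjoint G *\<^sub>v u = \<alpha> \<cdot>\<^sub>v (mat_adjoint Y *\<^sub>v (Y *\<^sub>v unit_vec (Suc m) 0))"
      using F yy(1) u(1) Fu vnorm2_col_unitary(2)[OF Y, of 0]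
        mult_mat_vec[of "mat_adjoint Y" "Suc m" "Suc m" "col Y 0" \<alpha>]
      by (simp add: G_def mat_adjoint_mult_dim assoc_mult_mat_vec_dim mult_mat_unit_vec)
    also have "\<dots> = \<alpha> \<cdot>\<^sub>v unit_vec (Suc m) 0" using Y by simp
    finally show ?thesis
      using mat_adjoint_mult_vec_index[OF G u(1), of "Suc j"] that by simp
  qed
  define G' where "G' = mat N (Suc m) (\<lambda>(i, j). case j of 0 \<Rightarrow> complex_of_real s * u $ i
      | Suc j' \<Rightarrow> complex_of_real (c j') * G $$ (i, j))"
  have G': "G' \<in> carrier_mat N (Suc m)" by (simp add: G'_def)
  have c0: "col G' 0 = complex_of_real s \<cdot>\<^sub>v u"
    using u(1) by (intro eq_vecI) (auto simp: G'_def)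
  have cS: "col G' (Suc j) = complex_of_real (c j) \<cdot>\<^sub>v col G (Suc j)" if "j < m" for j
    using that G by (intro eq_vecI) (auto simp: G'_def)
  define E' where "E' = mat_adjoint G' * Q * G'"
  have E'c: "E' \<in> carrier_mat (Suc m) (Suc m)" using G' by (simp add: E'_def)
  have E'i: "E' $$ (i, j) = (Q *\<^sub>v col G' j) \<bullet>c col G' i" if "i < Suc m" "j < Suc m" for i j
    unfolding E'_def using q(1) G' that by (rule congruence_index)
  have Bi: "B $$ (i, j) = (Q *\<^sub>v col G j) \<bullet>c col G i" if "i < Suc m" "j < Suc m" for i j
    unfolding BG using q(1) G that by (rule congruence_index)
  have E'00: "E' $$ (0, 0) = complex_of_real (k * s\<^sup>2)"
    using u q(1)
    by (simp add: E'i c0 mult_mat_vec[of _ N N] conjugate_smult_vec cscalar_prod_self power2_eq_square)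
  have E'SS: "E' $$ (Suc i, Suc j) = complex_of_real (c j * c i) * B $$ (Suc i, Suc j)"
    if "i < m" "j < m" for i j
    using that cGc[of "Suc i"] cGc[of "Suc j"] q(1)
    by (simp add: E'i cS mult_mat_vec[of _ N N] conjugate_smult_vec Bi)
  have E'0S: "E' $$ (Suc i, 0) = 0" if "i < m" for i
    using that cGc[of "Suc i"] u q(1) orth[OF that]
    by (simp add: E'i c0 cS mult_mat_vec[of _ N N] conjugate_smult_vec)
  \<comment> \<open>Orthogonality to \<open>u\<close> survives the application of \<open>Q\<close>
    because \<open>u\<close> is an eigenvector, so the new column does not interact with the old
    ones.\<close>
  have E'S0: "E' $$ (0, Suc j) = 0" if "j < m" for j
  proof -
    have "(Q *\<^sub>v col G (Suc j)) \<bullet>c u = col G (Suc j) \<bullet>c (Q *\<^sub>v u)"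
      using cscalar_prod_mult_mat_vec[OF q(1) cGc u(1)] q(2) by simp
    also have "\<dots> = complex_of_real k * cnj (u \<bullet>c col G (Suc j))"
      using u cGc[of "Suc j"] cscalar_prod_commute[OF u(1) cGc[of "Suc j"]]
      by (simp add: conjugate_smult_vec)
    finally show ?thesis
      using that cGc[of "Suc j"] u(1) q(1) orth[OF that]
      by (simp add: E'i c0 cS mult_mat_vec[of _ N N] conjugate_smult_vec)
  qed
  have E'd: "diagonal_mat E'"
    unfolding diagonal_mat_def
  proof (intro allI impI)
    fix i j assume "i < dim_row E'" "j < dim_col E'" "i \<noteq> j"
    then show "E' $$ (i, j) = 0"
      using E'c E'SS E'0S E'S0 Bo by (cases i; cases j) auto
  qed
  \<comment> \<open>\<open>E'\<close> is diagonal, so rotating by the eigenbasis \<open>X\<close> of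
    the old objective lets both objectives share their eigenvectors. Only eigenvalues remain to be
    compared.\<close>
  define F' where "F' = G' * mat_adjoint X"
  have objF': "objective Q F' = X * E' * mat_adjoint X"
    unfolding objective_def F'_def E'_def using G' xx(1) q(1)
    by (simp add: mat_adjoint_mult_dim assoc_mult_mat_dim)
  have "feasible N (Suc m) P \<tau> G'"
    unfolding feasible_iff
  proof (intro conjI ballI G')
    have "frob2 G' = (\<Sum>j<Suc m. vnorm2 (col G' j))"
      using G' by (simp add: frob2_def)
    also have "\<dots> = s\<^sup>2 + (\<Sum>j<m. (c j)\<^sup>2 * vnorm2 (F *\<^sub>v col Y (Suc j)))"
      unfolding sum.lessThan_Suc_shift using u(2) by (simp add: c0 cS cG)
    finally show "frob2 G' \<le> P" using s(2) by simp
    fix x :: "complex vec" assume x: "x \<in> carrier_vec N"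
    define \<beta> where "\<beta> = x \<bullet>c u"
    \<comment> \<open>Column 0 of \<open>G'\<close> sees only the component of \<open>x\<close>
      along \<open>u\<close>, the other columns only the remainder \<open>x'\<close>. The cap can
      thus be checked on the two parts separately.\<close>
    define x' where "x' = x - \<beta> \<cdot>\<^sub>v u"
    have x': "x' \<in> carrier_vec N" using x u by (simp add: x'_def)
    have "vnorm2 x' = vnorm2 x - 2 * Re (cnj \<beta> * \<beta>) + (cmod \<beta>)\<^sup>2"
      unfolding x'_def using vnorm2_diff_smult[OF x u(1), of \<beta>] u(2) by (simp add: \<beta>_def)
    also have "cnj \<beta> * \<beta> = complex_of_real ((cmod \<beta>)\<^sup>2)"
      by (simp only: complex_norm_square mult.commute)
    finally have nx': "vnorm2 x' = vnorm2 x - (cmod \<beta>)\<^sup>2" by simp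
    have xg: "x' \<bullet>c col G (Suc j) = x \<bullet>c col G (Suc j)" if "j < m" for j
      using x u(1) cGc[of "Suc j"] orth[OF that]
      by (simp add: x'_def minus_scalar_prod_distrib[of _ N])
    have "vnorm2 (mat_adjoint G' *\<^sub>v x) = (\<Sum>j<Suc m. (cmod (x \<bullet>c col G' j))\<^sup>2)"
      using G' x by (subst vnorm2_sum[of _ "Suc m"])
        (auto simp: mat_adjoint_mult_vec_index[OF G' x] simp del: index_mult_mat_vec sum.lessThan_Suc)
    also have "\<dots> = s\<^sup>2 * (cmod \<beta>)\<^sup>2 + (\<Sum>j<m. (c j)\<^sup>2 * (cmod (x' \<bullet>c col G (Suc j)))\<^sup>2)"
      unfolding sum.lessThan_Suc_shift using u(1) x cGc
      by (simp add: c0 cS xg conjugate_smult_vec norm_mult power_mult_distrib \<beta>_def)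
    also have "\<dots> \<le> \<tau> * (cmod \<beta>)\<^sup>2 + (\<Sum>j<m. (cmod (x' \<bullet>c col G (Suc j)))\<^sup>2)"
      using s(1) c(1) by (intro add_mono mult_right_mono sum_mono mult_left_le_one_le) (auto simp: power_le_one)
    \<comment> \<open>Adding the term of the old column 0 completes the sum to a norm for
      \<open>G\<close>, to which the cap on \<open>F\<close> applies.\<close>
    also have "(\<Sum>j<m. (cmod (x' \<bullet>c col G (Suc j)))\<^sup>2) \<le> (\<Sum>j<Suc m. (cmod (x' \<bullet>c col G j))\<^sup>2)"
      unfolding sum.lessThan_Suc_shift by simp
    also have "\<dots> = vnorm2 (mat_adjoint G *\<^sub>v x')"
      using G x' by (subst vnorm2_sum[of _ "Suc m"])
        (auto simp: mat_adjoint_mult_vec_index[OF G x'] simp del: index_mult_mat_vec sum.lessThan_Suc)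
    also have "\<dots> = vnorm2 (mat_adjoint F *\<^sub>v x')"
      using F yy(1) x' vnorm2_unitary[OF unitary_mat_adjoint[OF Y], of "mat_adjoint F *\<^sub>v x'"]
      by (simp add: G_def mat_adjoint_mult_dim assoc_mult_mat_vec_dim)
    also have "\<dots> \<le> \<tau> * vnorm2 x'"
      using feas x' by (simp add: feasible_iff)
    finally show "vnorm2 (mat_adjoint G' *\<^sub>v x) \<le> \<tau> * vnorm2 x"
      by (simp add: nx' algebra_simps)
  qed
  then have feas': "feasible N (Suc m) P \<tau> F'"
    unfolding F'_def using feasible_mult_unitary[OF X G'] by simp
  have E'e: "Re (E' $$ (Suc j, Suc j)) = Re (E $$ (Suc j, Suc j))" if "j < m" for j
    using that c(2)[OF that] by (simp add: E'SS power2_eq_square)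
  \<comment> \<open>The two spectra agree except at index 0, where the competitor is strictly larger
    by \<open>neg\<close>.\<close>
  have qf: "quad_form (objective Q F') x - quad_form (objective Q F) x
      = (k * s\<^sup>2 - Re (E $$ (0, 0))) * (cmod ((mat_adjoint X *\<^sub>v x) $ 0))\<^sup>2"
    if "x \<in> carrier_vec (Suc m)" for x
    unfolding objF' obj quad_form_evd[OF X E that] quad_form_evd[OF X E'c E'd that]
      sum.lessThan_Suc_shift
    using E'00 E'e by (simp add: left_diff_distrib del: index_mult_mat_vec)
  have "quad_form (objective Q F) x \<le> quad_form (objective Q F') x" if "x \<in> carrier_vec (Suc m)" for x
    using qf[OF that] neg by (smt (verit) mult_nonneg_nonneg zero_le_power2)
  then have "objective Q F' = objective Q F"
    by (rule pareto_optimalD[OF Q par feas'])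
  \<comment> \<open>The form at \<open>col X 0\<close> isolates the eigenvalue at index 0, so equal
    objectives are impossible.\<close>
  moreover have "mat_adjoint X *\<^sub>v col X 0 = unit_vec (Suc m) 0"
    using unitary_mat_cancel_vec(1)[OF X, of "unit_vec (Suc m) 0"] xx(1) by (simp add: mult_mat_unit_vec)
  ultimately show False
    using qf[of "col X 0"] neg vnorm2_col_unitary[OF X, of 0] by (simp del: index_mult_mat_vec)
qed

text \<open>A balance of power against objective. Shrinking the other columns costs at most
  \<open>k\<close> times the power it frees, while optimality bounds \<open>k\<close> times the
  power \<open>r\<close> available to column 0 by the top eigenvalue of the objective. Since
  \<open>B\<close> and \<open>E\<close> have equal trace, the form of \<open>Q\<close> at
  \<open>g 0\<close> is at least \<open>k * vnorm2 (g 0)\<close>; the Rayleigh bound then holds with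
  equality.\<close>

lemma pareto_range_top_eigenspace:
  assumes Q: "psd_mat N Q" and par: "pareto_optimal N (Suc m) P \<tau> Q F" and \<tau>: "\<tau> > 0"
    and evd: "descending_evd N Q U D" and N: "0 < N"
    and evdM: "descending_evd (Suc m) (objective Q F) X E"
    and slack: "Re (E $$ (0, 0)) < \<tau> * Re (D $$ (0, 0))"
    and u: "u \<in> carrier_vec N" "vnorm2 u = 1" "Q *\<^sub>v u = D $$ (0, 0) \<cdot>\<^sub>v u"
    and v: "v \<in> carrier_vec (Suc m)" "vnorm2 v = 1" and Fu: "mat_adjoint F *\<^sub>v u = \<alpha> \<cdot>\<^sub>v v"
  shows "Q *\<^sub>v (F *\<^sub>v v) = D $$ (0, 0) \<cdot>\<^sub>v (F *\<^sub>v v)"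
proof -
  have qh: "hermitian_mat N Q" and q0: "\<And>x. x \<in> carrier_vec N \<Longrightarrow> 0 \<le> quad_form Q x"
    using Q by (auto simp: psd_mat_iff)
  note q = hermitian_matD[OF qh]
  have feas: "feasible N (Suc m) P \<tau> F" using par by (simp add: pareto_optimal_def)
  then have F: "F \<in> carrier_mat N (Suc m)" by (simp add: feasible_def)
  define M where "M = objective Q F"
  have M: "hermitian_mat (Suc m) M"
    unfolding M_def objective_def using qh F by (rule hermitian_congruence)
  have qM: "quad_form M x = quad_form Q (F *\<^sub>v x)" if "x \<in> carrier_vec (Suc m)" for x
    unfolding M_def objective_def using q(1) F that by (rule quad_form_congruence)
  note d = descending_evdD[OF evd] and e = descending_evdD[OF evdM[folded M_def]]
  note xx = unitary_matD[OF e(1)]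
  define k where "k = Re (D $$ (0, 0))"
  have kD: "complex_of_real k = D $$ (0, 0)" using d(5)[OF N] by (simp add: k_def)
  have qk: "quad_form Q x \<le> k * vnorm2 x" if "x \<in> carrier_vec N" for x
    unfolding k_def using evd that N by (rule evd_quad_form_le)
  obtain Y where Y: "unitary_mat (Suc m) Y" "col Y 0 = v"
    and Bo: "\<And>i j. 1 \<le> i \<Longrightarrow> i < Suc m \<Longrightarrow> 1 \<le> j \<Longrightarrow> j < Suc m \<Longrightarrow> i \<noteq> j \<Longrightarrow>
       (mat_adjoint Y * M * Y) $$ (i, j) = 0"
    and Bd: "\<And>i j. 1 \<le> i \<Longrightarrow> i \<le> j \<Longrightarrow> j < Suc m \<Longrightarrow>
       Re ((mat_adjoint Y * M * Y) $$ (j, j)) \<le> Re ((mat_adjoint Y * M * Y) $$ (i, i))"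
    using compression_evd[OF M v] by blast
  note yy = unitary_matD[OF Y(1)]
  define B where "B = mat_adjoint Y * M * Y"
  have Mc: "M \<in> carrier_mat (Suc m) (Suc m)" using M by (rule hermitian_matD)
  \<comment> \<open>The change from the eigenbasis \<open>X\<close> to the basis \<open>Y\<close>
    turns \<open>B\<close> into a congruence of the diagonal matrix \<open>E\<close>, as interlacing
    requires.\<close>
  define Z where "Z = mat_adjoint X * Y"
  have Z: "unitary_mat (Suc m) Z"
    unfolding Z_def using e(1) Y(1) by (intro unitary_mat_mult unitary_mat_adjoint)
  have BZ: "B = mat_adjoint Z * E * Z"
    unfolding B_def Z_def e(4) using xx(1) yy(1) e(2)
    by (simp add: mat_adjoint_mult_dim assoc_mult_mat_dim)
  have EB: "Re (E $$ (Suc j, Suc j)) \<le> Re (B $$ (Suc j, Suc j))" if "j < m" for j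
    using that by (intro compression_eigenvalue_ge[OF Z e(2,3) e(6) BZ Bo[folded B_def] Bd[folded B_def]]) auto
  define g where "g j = F *\<^sub>v col Y j" for j
  have gc: "g j \<in> carrier_vec N" for j using F by (simp add: g_def)
  have yc: "col Y j \<in> carrier_vec (Suc m)" if "j < Suc m" for j
    using vnorm2_col_unitary(2)[OF Y(1) that] .
  have Bg: "Re (B $$ (j, j)) = quad_form Q (g j)" if "j < Suc m" for j
    using congruence_index[OF Mc yy(1) that that] qM[OF yc[OF that]]
    by (simp add: B_def quad_form_def g_def)
  have E0: "0 \<le> Re (E $$ (j, j))" if "j < Suc m" for j
  proof -
    have "Re (E $$ (j, j)) = quad_form M (col X j)"
      using evd_eigenvector[OF e(1-3) that] vnorm2_col_unitary[OF e(1) that]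
      by (simp add: e(4)[symmetric] quad_form_def cscalar_prod_self)
    also have "\<dots> \<ge> 0"
      using qM[OF vnorm2_col_unitary(2)[OF e(1) that]] q0[of "F *\<^sub>v col X j"] F by simp
    finally show ?thesis .
  qed
  \<comment> \<open>If the denominator vanishes then so does the numerator, and \<open>c j = 0\<close>.\<close>
  define c where "c j = sqrt (Re (E $$ (Suc j, Suc j)) / Re (B $$ (Suc j, Suc j)))" for j
  have c2: "(c j)\<^sup>2 = Re (E $$ (Suc j, Suc j)) / Re (B $$ (Suc j, Suc j))" if "j < m" for j
    using E0[of "Suc j"] EB[OF that] that by (simp add: c_def)
  have cB: "(c j)\<^sup>2 * Re (B $$ (Suc j, Suc j)) = Re (E $$ (Suc j, Suc j))" if "j < m" for j
    using E0[of "Suc j"] EB[OF that] that by (auto simp: c2)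
  have c01: "0 \<le> c j \<and> c j \<le> 1" if "j < m" for j
    using E0[of "Suc j"] EB[OF that] that by (auto simp: c_def divide_le_eq_1)
  \<comment> \<open>The power left for column 0 once the other columns are shrunk.\<close>
  define r where "r = P - (\<Sum>j<m. (c j)\<^sup>2 * vnorm2 (g (Suc j)))"
  have "frob2 (F * Y) = frob2 F"
    using frob2_mult_unitary[OF unitary_mat_adjoint[OF Y(1)] F] by simp
  moreover have "frob2 (F * Y) = (\<Sum>j<Suc m. vnorm2 (g j))"
    unfolding frob2_def using F yy(1)
    by (intro sum.cong) (auto simp: g_def col_mult2[OF F yy(1)] simp del: col_mult)
  ultimately have P: "vnorm2 (g 0) + (\<Sum>j<m. vnorm2 (g (Suc j))) \<le> P"
    unfolding sum.lessThan_Suc_shift using feas by (simp add: feasible_iff)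
  have r: "vnorm2 (g 0) + (\<Sum>j<m. (1 - (c j)\<^sup>2) * vnorm2 (g (Suc j))) \<le> r"
    using P by (simp add: r_def left_diff_distrib sum_subtractf)
  have csq: "(c j)\<^sup>2 \<le> 1" if "j < m" for j
    using c01[OF that] by (simp add: power_le_one)
  have "0 \<le> (\<Sum>j<m. (1 - (c j)\<^sup>2) * vnorm2 (g (Suc j)))"
    using csq by (intro sum_nonneg mult_nonneg_nonneg) auto
  then have r0: "0 \<le> r" using r vnorm2_nonneg[of "g 0"] by linarith
  \<comment> \<open>The largest column length that the norm cap and the remaining power both
    permit.\<close>
  define s where "s = sqrt (min \<tau> r)"
  have s2: "s\<^sup>2 = min \<tau> r" using r0 \<tau> by (simp add: s_def)
  have "k * s\<^sup>2 \<le> Re (E $$ (0, 0))"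
  proof (rule pareto_reallocation_bound[OF qh par u(1,2) _ e(1-3) e(4)[unfolded M_def] Y(1) _ _ _ c01 _])
    show "Q *\<^sub>v u = complex_of_real k \<cdot>\<^sub>v u" using u(3) kD by simp
    show "mat_adjoint F *\<^sub>v u = \<alpha> \<cdot>\<^sub>v col Y 0" using Fu Y(2) by simp
    show "B = mat_adjoint Y * objective Q F * Y" by (simp add: B_def M_def)
    show "s\<^sup>2 + (\<Sum>j<m. (c j)\<^sup>2 * vnorm2 (F *\<^sub>v col Y (Suc j))) \<le> P"
      using s2 by (simp add: r_def g_def)
  qed (use Bo cB s2 in \<open>auto simp: B_def\<close>)
  \<comment> \<open>If the cap were the active bound, the new column would reach \<tau> k, against
    \<open>slack\<close>; so power is the active bound.\<close>
  then have kr: "k * r \<le> Re (E $$ (0, 0))"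
    using slack s2 by (cases "\<tau> \<le> r") (auto simp: k_def mult.commute)
  have "0 < \<tau> * k" using slack E0[of 0] by (simp add: k_def)
  then have k: "0 < k" using \<tau> by (simp add: zero_less_mult_iff)
  \<comment> \<open>The loss in column \<open>j\<close> is the fraction
    \<open>1 - (c j)\<^sup>2\<close> of its form value, and the Rayleigh bound limits that value by
    \<open>k\<close> times its power.\<close>
  have "k * ((1 - (c j)\<^sup>2) * vnorm2 (g (Suc j))) \<ge> Re (B $$ (Suc j, Suc j)) - Re (E $$ (Suc j, Suc j))"
    if "j < m" for j
  proof -
    have "(1 - (c j)\<^sup>2) * Re (B $$ (Suc j, Suc j)) \<le> (1 - (c j)\<^sup>2) * (k * vnorm2 (g (Suc j)))"
      using csq[OF that] qk[OF gc] Bg[of "Suc j"] that by (intro mult_left_mono) auto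
    then show ?thesis using cB[OF that] by (simp add: algebra_simps)
  qed
  then have "(\<Sum>j<m. Re (B $$ (Suc j, Suc j)) - Re (E $$ (Suc j, Suc j)))
      \<le> k * (\<Sum>j<m. (1 - (c j)\<^sup>2) * vnorm2 (g (Suc j)))"
    unfolding sum_distrib_left by (intro sum_mono) auto
  moreover have "k * (vnorm2 (g 0) + (\<Sum>j<m. (1 - (c j)\<^sup>2) * vnorm2 (g (Suc j)))) \<le> k * r"
    using r k by (intro mult_left_mono) auto
  moreover have "(\<Sum>j<Suc m. Re (B $$ (j, j))) = (\<Sum>j<Suc m. Re (E $$ (j, j)))"
  proof -
    have "mat_trace B = mat_trace E" unfolding BZ using Z e(2) by (rule mat_trace_unitary)
    moreover have "B \<in> carrier_mat (Suc m) (Suc m)" using yy(1) by (simp add: B_def)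
    ultimately show ?thesis using e(2) by (simp add: mat_trace_def flip: Re_sum)
  qed
  ultimately have "k * vnorm2 (g 0) \<le> Re (B $$ (0, 0))"
    using kr unfolding sum.lessThan_Suc_shift by (simp add: sum_subtractf distrib_left)
  then have "quad_form Q (g 0) = k * vnorm2 (g 0)"
    using qk[OF gc[of 0]] Bg[of 0] by simp
  then have "Q *\<^sub>v g 0 = D $$ (0, 0) \<cdot>\<^sub>v g 0"
    unfolding k_def by (intro evd_quad_form_eq[OF evd gc N])
  then show ?thesis by (simp add: g_def Y(2))
qed

text \<open>A nonzero element of \<open>W\<close> with the fewest nonzero eigencoordinates is an eigenvector.\<close>

lemma hermitian_eigenvector_in_invariant:
  assumes S: "hermitian_mat n S" and W: "W \<subseteq> carrier_vec n"
    and inv: "\<And>x c. x \<in> W \<Longrightarrow> S *\<^sub>v x - c \<cdot>\<^sub>v x \<in> W"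
    and x0: "x0 \<in> W" "x0 \<noteq> 0\<^sub>v n"
  shows "\<exists>x \<in> W. x \<noteq> 0\<^sub>v n \<and> (\<exists>c. S *\<^sub>v x = c \<cdot>\<^sub>v x)"
proof -
  obtain X E where "descending_evd n S X E" using hermitian_descending_evd[OF S] by blast
  note e = descending_evdD[OF this]
  note xx = unitary_matD[OF e(1)]
  define supp where "supp x = {i. i < n \<and> (mat_adjoint X *\<^sub>v x) $ i \<noteq> 0}" for x
  obtain x where x: "x \<in> W" "x \<noteq> 0\<^sub>v n"
    and least: "\<And>y. y \<in> W \<Longrightarrow> y \<noteq> 0\<^sub>v n \<Longrightarrow> card (supp x) \<le> card (supp y)"
    using ex_has_least_nat[of "\<lambda>x. x \<in> W \<and> x \<noteq> 0\<^sub>v n" x0 "\<lambda>x. card (supp x)"] x0 by auto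
  have xc: "x \<in> carrier_vec n" using x W by auto
  define y where "y = mat_adjoint X *\<^sub>v x"
  have y: "y \<in> carrier_vec n" using xx(1) by (simp add: y_def)
  have Xy: "X *\<^sub>v y = x" using e(1) xc by (simp add: y_def)
  have "y \<noteq> 0\<^sub>v n" using Xy x(2) xx(1) by auto
  then obtain i where i: "i < n" "y $ i \<noteq> 0" using y by (metis carrier_vecD eq_vecI index_zero_vec)
  \<comment> \<open>Subtracting this multiple kills eigencoordinate \<open>i\<close> and creates no
    new one, so minimality of the support leaves only \<open>z = 0\<close>.\<close>
  define z where "z = S *\<^sub>v x - E $$ (i, i) \<cdot>\<^sub>v x"
  have z: "z \<in> W" unfolding z_def using x(1) by (rule inv)
  have Sc: "S \<in> carrier_mat n n" using S by (rule hermitian_matD)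
  have "mat_adjoint X *\<^sub>v (S *\<^sub>v x) = E *\<^sub>v y"
    unfolding e(4) using xx(1) e(1,2) xc y by (simp add: assoc_mult_mat_vec_dim y_def)
  moreover have "mat_adjoint X *\<^sub>v z = mat_adjoint X *\<^sub>v (S *\<^sub>v x) - E $$ (i, i) \<cdot>\<^sub>v y"
    using mult_minus_distrib_mat_vec[of "mat_adjoint X" n n "S *\<^sub>v x" "E $$ (i, i) \<cdot>\<^sub>v x"]
      mult_mat_vec[of "mat_adjoint X" n n x "E $$ (i, i)"] xx(1) xc Sc
    by (simp add: z_def y_def)
  ultimately have "(mat_adjoint X *\<^sub>v z) $ j = (E $$ (j, j) - E $$ (i, i)) * y $ j" if "j < n" for j
    using that y e(2) diagonal_mat_mult_vec[OF e(2,3) y that that]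
    by (simp add: left_diff_distrib del: index_mult_mat_vec)
  then have "supp z \<subseteq> supp x" "i \<notin> supp z"
    by (auto simp: supp_def y_def simp del: index_mult_mat_vec)
  moreover have "i \<in> supp x" using i by (simp add: supp_def y_def del: index_mult_mat_vec)
  ultimately have "supp z \<subset> supp x" by blast
  then have "card (supp z) < card (supp x)" by (intro psubset_card_mono) (auto simp: supp_def)
  then have "z = 0\<^sub>v n" using least[OF z] by auto
  then have "S *\<^sub>v x = E $$ (i, i) \<cdot>\<^sub>v x"
  proof (intro eq_vecI)
    fix j assume "j < dim_vec (E $$ (i, i) \<cdot>\<^sub>v x)"
    then show "(S *\<^sub>v x) $ j = (E $$ (i, i) \<cdot>\<^sub>v x) $ j"
      using arg_cong[OF \<open>z = 0\<^sub>v n\<close>, of "\<lambda>v. v $ j"] xc Sc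
      by (simp add: z_def del: index_mult_mat_vec)
  qed (use xc Sc in simp)
  then show ?thesis using x by blast
qed

text \<open>If the objective does not attain the value \<tau> k with \<open>k\<close> positive, the
  top eigenspace \<open>W\<close> of \<open>Q\<close> contains \<open>F *\<^sub>v v\<close> whenever
  \<open>v\<close> is a unit vector parallel to the image of a unit vector of \<open>W\<close> under
  the adjoint. The pair then comes from an eigenvector of F F^H in \<open>W\<close>, or of F^H F if
  the adjoint kills a unit vector of \<open>W\<close>.\<close>

lemma pareto_singular_pair:
  assumes Q: "psd_mat N Q" and par: "pareto_optimal N (Suc m) P \<tau> Q F" and \<tau>: "\<tau> > 0"
    and evd: "descending_evd N Q U D" and N: "0 < N"
  shows "\<exists>u v s. u \<in> carrier_vec N \<and> v \<in> carrier_vec (Suc m) \<and> vnorm2 u = 1 \<and> vnorm2 v = 1 \<and>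
    0 \<le> s \<and> Q *\<^sub>v u = D $$ (0, 0) \<cdot>\<^sub>v u \<and> F *\<^sub>v v = complex_of_real s \<cdot>\<^sub>v u \<and>
    mat_adjoint F *\<^sub>v u = complex_of_real s \<cdot>\<^sub>v v"
proof -
  have qh: "hermitian_mat N Q" and q0: "\<And>x. x \<in> carrier_vec N \<Longrightarrow> 0 \<le> quad_form Q x"
    using Q by (auto simp: psd_mat_iff)
  note q = hermitian_matD[OF qh]
  have feas: "feasible N (Suc m) P \<tau> F" using par by (simp add: pareto_optimal_def)
  then have F: "F \<in> carrier_mat N (Suc m)" by (simp add: feasible_def)
  have le: "vnorm2 (mat_adjoint F *\<^sub>v x) \<le> \<tau> * vnorm2 x" if "x \<in> carrier_vec N" for x
    using feas that by (simp add: feasible_iff)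
  have contr: "vnorm2 (F *\<^sub>v v) \<le> \<tau> * vnorm2 v"
    "vnorm2 (F *\<^sub>v v) = \<tau> * vnorm2 v \<Longrightarrow>
      mat_adjoint F *\<^sub>v (F *\<^sub>v v) = complex_of_real \<tau> \<cdot>\<^sub>v v"
    if "v \<in> carrier_vec (Suc m)" for v
    using contraction_adjoint[OF F \<tau> _ that] le by blast+
  define k where "k = D $$ (0, 0)"
  have qk: "quad_form Q x \<le> Re k * vnorm2 x" if "x \<in> carrier_vec N" for x
    unfolding k_def using evd that N by (rule evd_quad_form_le)
  have eqk: "Q *\<^sub>v x = k \<cdot>\<^sub>v x" if "x \<in> carrier_vec N" "quad_form Q x = Re k * vnorm2 x" for x
    unfolding k_def using evd that N by (intro evd_quad_form_eq) (auto simp: k_def)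
  note d = descending_evdD[OF evd]
  have ktop: "Q *\<^sub>v col U 0 = k \<cdot>\<^sub>v col U 0" "vnorm2 (col U 0) = 1" "col U 0 \<in> carrier_vec N"
    using evd_eigenvector[OF d(1-3) N] vnorm2_col_unitary[OF d(1) N] by (simp_all add: d(4)[symmetric] k_def)
  then have k0: "0 \<le> Re k" using q0[of "col U 0"] qk[of "col U 0"] by simp
  obtain X E where evdM: "descending_evd (Suc m) (objective Q F) X E"
    using hermitian_descending_evd hermitian_congruence[OF qh F] unfolding objective_def by blast
  note e = descending_evdD[OF evdM]
  define f where "f = F *\<^sub>v col X 0"
  have fc: "f \<in> carrier_vec N" using F by (simp add: f_def)
  note x0 = vnorm2_col_unitary[OF e(1), of 0, simplified]
  have qf: "quad_form Q f = Re (E $$ (0, 0))"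
    using quad_form_congruence[OF q(1) F x0(2)] evd_eigenvector[OF e(1-3), of 0] x0
    by (simp add: e(4)[symmetric] objective_def[symmetric] f_def[symmetric])
      (simp add: quad_form_def cscalar_prod_self)
  have f\<tau>: "vnorm2 f \<le> \<tau>" using contr(1)[OF x0(2)] x0(1) by (simp add: f_def)
  then have ef: "Re (E $$ (0, 0)) \<le> Re k * vnorm2 f" "Re k * vnorm2 f \<le> Re k * \<tau>"
    using qk[OF fc] qf k0 by (auto intro: mult_left_mono)
  show ?thesis
  \<comment> \<open>The condition \<open>0 < Re k\<close> allows cancelling \<open>k\<close>, so
    that equality forces \<open>f\<close> to have squared norm \<tau>.\<close>
  proof (cases "Re (E $$ (0, 0)) = \<tau> * Re k \<and> 0 < Re k")
    case True
    then have "Re k * vnorm2 f = Re k * \<tau>" using ef by (simp add: mult.commute)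
    then have nf: "vnorm2 f = \<tau>" using True by simp
    then have "Q *\<^sub>v f = k \<cdot>\<^sub>v f" using eqk[OF fc] qf True by (simp add: mult.commute)
    moreover have "mat_adjoint F *\<^sub>v f = complex_of_real \<tau> \<cdot>\<^sub>v col X 0"
      using contr(2)[OF x0(2)] x0(1) nf by (simp add: f_def)
    moreover define a where "a = complex_of_real (1 / sqrt \<tau>)"
    moreover have "a * complex_of_real \<tau> = complex_of_real (sqrt \<tau>)"
      using \<tau> by (simp add: a_def real_div_sqrt flip: of_real_mult of_real_divide)
    moreover have "complex_of_real (sqrt \<tau>) * a = 1" using \<tau> by (simp add: a_def)
    moreover have "vnorm2 (a \<cdot>\<^sub>v f) = 1"
      using \<tau> nf by (simp add: a_def norm_divide power_divide)
    ultimately show ?thesis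
      using x0 fc q(1) F \<tau>
      by (intro exI[of _ "a \<cdot>\<^sub>v f"] exI[of _ "col X 0"] exI[of _ "sqrt \<tau>"])
        (simp add: mult_mat_vec[of Q N N] mult_mat_vec[of "mat_adjoint F" "Suc m" N]
          smult_smult_assoc mult.commute k_def[symmetric] f_def[symmetric])
  next
    case False
    define W where "W = {x \<in> carrier_vec N. Q *\<^sub>v x = k \<cdot>\<^sub>v x}"
    have Wsmult: "a \<cdot>\<^sub>v x \<in> W" if "x \<in> W" for a x
      using that q(1) by (auto simp: W_def mult_mat_vec[of Q N N] smult_smult_assoc mult.commute)
    have Wdiff: "x - y \<in> W" if "x \<in> W" "y \<in> W" for x y
      using that q(1) by (auto simp: W_def mult_minus_distrib_mat_vec[of Q N N] intro!: eq_vecI)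
        (simp_all add: right_diff_distrib del: index_mult_mat_vec)
    have Wunit: "F *\<^sub>v v \<in> W"
      if "u \<in> W" "vnorm2 u = 1" "v \<in> carrier_vec (Suc m)" "vnorm2 v = 1"
        "mat_adjoint F *\<^sub>v u = \<alpha> \<cdot>\<^sub>v v" for u v \<alpha>
    proof (cases "Re k = 0")
      case True
      \<comment> \<open>With top eigenvalue 0 the nonnegative form vanishes everywhere, so the
        Rayleigh bound is attained.\<close>
      have "quad_form Q (F *\<^sub>v v) = Re k * vnorm2 (F *\<^sub>v v)"
        using qk[of "F *\<^sub>v v"] q0[of "F *\<^sub>v v"] F True by simp
      then show ?thesis using eqk[of "F *\<^sub>v v"] F by (simp add: W_def)
    next
      case nz: False
      then have "Re (E $$ (0, 0)) < \<tau> * Re k"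
        using False order_trans[OF ef] k0 by (auto simp: mult.commute)
      then show ?thesis
        using pareto_range_top_eigenspace[OF Q par \<tau> evd N evdM] that F by (auto simp: W_def k_def)
    qed
    have unit: "complex_of_real (1 / sqrt (vnorm2 x)) \<cdot>\<^sub>v x \<in> W"
      "vnorm2 (complex_of_real (1 / sqrt (vnorm2 x)) \<cdot>\<^sub>v x) = 1"
      if "x \<in> W" "x \<noteq> 0\<^sub>v N" for x
      using that Wsmult normalize_vec[of x N] by (auto simp: W_def)
    have "\<exists>u v s. u \<in> W \<and> v \<in> carrier_vec (Suc m) \<and> vnorm2 u = 1 \<and> vnorm2 v = 1 \<and> 0 \<le> s \<and>
      F *\<^sub>v v = complex_of_real s \<cdot>\<^sub>v u \<and> mat_adjoint F *\<^sub>v u = complex_of_real s \<cdot>\<^sub>v v"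
    proof (cases "\<exists>u \<in> W. vnorm2 u = 1 \<and> mat_adjoint F *\<^sub>v u = 0\<^sub>v (Suc m)")
      case True
      then obtain u where u: "u \<in> W" "vnorm2 u = 1" "mat_adjoint F *\<^sub>v u = 0\<^sub>v (Suc m)" by blast
      have "hermitian_mat (Suc m) (mat_adjoint F * F)"
        using hermitian_mult_adjoint[of "mat_adjoint F" "Suc m" N] F by simp
      then obtain X2 E2 where "descending_evd (Suc m) (mat_adjoint F * F) X2 E2"
        using hermitian_descending_evd by blast
      note e2 = descending_evdD[OF this]
      define v where "v = col X2 0"
      have v: "vnorm2 v = 1" "v \<in> carrier_vec (Suc m)"
        using vnorm2_col_unitary[OF e2(1), of 0] by (simp_all add: v_def)
      have "mat_adjoint F * F *\<^sub>v v = E2 $$ (0, 0) \<cdot>\<^sub>v v"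
        using evd_eigenvector[OF e2(1-3), of 0] by (simp add: e2(4)[symmetric] v_def)
      then have FFv: "mat_adjoint F *\<^sub>v (F *\<^sub>v v) = E2 $$ (0, 0) \<cdot>\<^sub>v v"
        using F v by (simp add: assoc_mult_mat_vec_dim)
      have "mat_adjoint F *\<^sub>v u = 0 \<cdot>\<^sub>v v" using u(3) v(2) by (auto intro!: eq_vecI)
      \<comment> \<open>The zero image is a multiple of any vector, so \<open>v\<close> could be
        chosen freely, here as an eigenvector of F^H F.\<close>
      then have FvW: "F *\<^sub>v v \<in> W" using Wunit[OF u(1,2) v(2,1)] by blast
      have nFv: "E2 $$ (0, 0) = complex_of_real (vnorm2 (F *\<^sub>v v))"
      proof -
        have "(mat_adjoint F *\<^sub>v (F *\<^sub>v v)) \<bullet>c v = complex_of_real (vnorm2 (F *\<^sub>v v))"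
          using cscalar_prod_mult_mat_vec[of "mat_adjoint F" "Suc m" N "F *\<^sub>v v" v] F v
          by (simp add: cscalar_prod_self)
        then show ?thesis using FFv v by (simp add: cscalar_prod_self)
      qed
      show ?thesis
      proof (cases "F *\<^sub>v v = 0\<^sub>v N")
        case True
        have "F *\<^sub>v v = 0 \<cdot>\<^sub>v u" using True u(1) by (auto simp: W_def intro!: eq_vecI)
        then show ?thesis
          using u v \<open>mat_adjoint F *\<^sub>v u = 0 \<cdot>\<^sub>v v\<close>
          \<comment> \<open>If \<open>F\<close> kills \<open>v\<close>, the pair has singular value
            0 and any such \<open>u\<close> serves.\<close>
          by (intro exI[of _ u] exI[of _ v] exI[of _ 0]) simp
      next
        case nz: False
        define t where "t = vnorm2 (F *\<^sub>v v)"
        have t: "0 < t"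
          using nz F vnorm2_eq_0[of "F *\<^sub>v v" N] vnorm2_nonneg[of "F *\<^sub>v v"] by (simp add: t_def less_le)
        define a where "a = complex_of_real (1 / sqrt t)"
        have a: "complex_of_real (sqrt t) * a = 1" "a * complex_of_real t = complex_of_real (sqrt t)"
          using t by (simp_all add: a_def real_div_sqrt flip: of_real_mult of_real_divide)
        have "a \<cdot>\<^sub>v (F *\<^sub>v v) \<in> W" "vnorm2 (a \<cdot>\<^sub>v (F *\<^sub>v v)) = 1"
          using unit[OF FvW nz] by (simp_all only: a_def t_def)
        then show ?thesis
          using v F FFv nFv t a
          by (intro exI[of _ "a \<cdot>\<^sub>v (F *\<^sub>v v)"] exI[of _ v] exI[of _ "sqrt t"])
            (simp add: t_def[symmetric] mult_mat_vec[of "mat_adjoint F" "Suc m" N]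
              smult_smult_assoc)
      qed
    next
      case ninj: False
      define S where "S = F * mat_adjoint F"
      have S: "hermitian_mat N S" unfolding S_def using F by (rule hermitian_mult_adjoint)
      have SF: "S *\<^sub>v x = F *\<^sub>v (mat_adjoint F *\<^sub>v x)" if "x \<in> carrier_vec N" for x
        unfolding S_def using F that by (simp add: assoc_mult_mat_vec_dim)
      \<comment> \<open>The image of \<open>x\<close> under the adjoint is nonzero by
        \<open>ninj\<close>; normalised, it is the \<open>v\<close> of \<open>Wunit\<close>, and
        \<open>S\<close> maps \<open>x\<close> to a multiple of
        \<open>F *\<^sub>v v\<close>.\<close>
      have inv1: "S *\<^sub>v x \<in> W" if x: "x \<in> W" "vnorm2 x = 1" for x
      proof -
        define w where "w = mat_adjoint F *\<^sub>v x"
        have w: "w \<in> carrier_vec (Suc m)" using F by (simp add: w_def)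
        have "w \<noteq> 0\<^sub>v (Suc m)" using ninj x by (auto simp: w_def)
        then have w0: "0 < vnorm2 w"
          using w vnorm2_eq_0[of w "Suc m"] vnorm2_nonneg[of w] by (simp add: less_le)
        define b where "b = complex_of_real (sqrt (vnorm2 w))"
        define v where "v = complex_of_real (1 / sqrt (vnorm2 w)) \<cdot>\<^sub>v w"
        have "w = b \<cdot>\<^sub>v v" using w0 by (simp add: v_def b_def smult_smult_assoc)
        moreover have v: "v \<in> carrier_vec (Suc m)" "vnorm2 v = 1"
          using w \<open>w \<noteq> 0\<^sub>v (Suc m)\<close> normalize_vec[of w "Suc m"] by (simp_all add: v_def)
        ultimately have "F *\<^sub>v v \<in> W" using Wunit[OF x v, of b] by (simp add: w_def)
        moreover have "S *\<^sub>v x = b \<cdot>\<^sub>v (F *\<^sub>v v)"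
          using SF[of x] x(1) \<open>w = b \<cdot>\<^sub>v v\<close> F v(1)
          by (simp add: W_def w_def[symmetric] mult_mat_vec[of F N "Suc m"])
        ultimately show ?thesis by (simp add: Wsmult)
      qed
      have inv: "S *\<^sub>v x \<in> W" if x: "x \<in> W" for x
      proof (cases "x = 0\<^sub>v N")
        case True
        have "S *\<^sub>v 0\<^sub>v N = 0\<^sub>v N" using hermitian_matD(1)[OF S] by (auto intro!: eq_vecI)
        then show ?thesis using True x by simp
      next
        case nz: False
        have xc: "x \<in> carrier_vec N" using x by (simp add: W_def)
        have "0 < vnorm2 x" using nz xc vnorm2_eq_0[of x N] vnorm2_nonneg[of x] by (simp add: less_le)
        then have "x = complex_of_real (sqrt (vnorm2 x)) \<cdot>\<^sub>v (complex_of_real (1 / sqrt (vnorm2 x)) \<cdot>\<^sub>v x)"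
          by (simp add: smult_smult_assoc)
        then have "S *\<^sub>v x = complex_of_real (sqrt (vnorm2 x)) \<cdot>\<^sub>v
            (S *\<^sub>v (complex_of_real (1 / sqrt (vnorm2 x)) \<cdot>\<^sub>v x))"
          using mult_mat_vec[OF hermitian_matD(1)[OF S], of "complex_of_real (1 / sqrt (vnorm2 x)) \<cdot>\<^sub>v x"
              "complex_of_real (sqrt (vnorm2 x))"] xc by simp
        then show ?thesis using inv1[OF unit[OF x nz]] by (simp only: Wsmult)
      qed
      have "col U 0 \<in> W" "col U 0 \<noteq> 0\<^sub>v N" using ktop by (auto simp: W_def)
      then obtain x c where x: "x \<in> W" "x \<noteq> 0\<^sub>v N" "S *\<^sub>v x = c \<cdot>\<^sub>v x"
        using hermitian_eigenvector_in_invariant[OF S, of W "col U 0"] inv Wsmult Wdiff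
        by (auto simp: W_def)
      define u where "u = complex_of_real (1 / sqrt (vnorm2 x)) \<cdot>\<^sub>v x"
      have u: "u \<in> W" "vnorm2 u = 1" using unit[OF x(1,2)] by (simp_all add: u_def)
      then have uc: "u \<in> carrier_vec N" by (simp add: W_def)
      have "S *\<^sub>v u = c \<cdot>\<^sub>v u"
        using x hermitian_matD(1)[OF S]
        by (simp add: u_def W_def mult_mat_vec[of S N N] smult_smult_assoc mult.commute)
      then have FFu: "F *\<^sub>v (mat_adjoint F *\<^sub>v u) = c \<cdot>\<^sub>v u" using SF[OF uc] by simp
      define w where "w = mat_adjoint F *\<^sub>v u"
      have w: "w \<in> carrier_vec (Suc m)" using F by (simp add: w_def)
      have wz: "w \<noteq> 0\<^sub>v (Suc m)" using ninj u by (auto simp: w_def)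
      define t where "t = vnorm2 w"
      have t: "0 < t"
        using wz w vnorm2_eq_0[of w "Suc m"] vnorm2_nonneg[of w] by (simp add: t_def less_le)
      have "(F *\<^sub>v w) \<bullet>c u = complex_of_real t"
        using cscalar_prod_mult_mat_vec[OF F w uc] by (simp add: w_def t_def cscalar_prod_self)
      \<comment> \<open>The eigenvalue is the squared norm of \<open>w\<close>, so dividing
        \<open>w\<close> by its norm gives singular value \<open>sqrt t\<close>.\<close>
      then have ct: "c = complex_of_real t"
        using FFu u(2) uc by (simp add: w_def cscalar_prod_self)
      define a where "a = complex_of_real (1 / sqrt t)"
      have a: "complex_of_real (sqrt t) * a = 1" "a * complex_of_real t = complex_of_real (sqrt t)"
        using t by (simp_all add: a_def real_div_sqrt flip: of_real_mult of_real_divide)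
      have "vnorm2 (a \<cdot>\<^sub>v w) = 1"
        using normalize_vec[OF w wz] by (simp only: a_def t_def)
      then show ?thesis
        using u w F FFu ct t a
        by (intro exI[of _ u] exI[of _ "a \<cdot>\<^sub>v w"] exI[of _ "sqrt t"])
          (simp add: t_def[symmetric] w_def[symmetric] mult_mat_vec[of F N "Suc m"]
            smult_smult_assoc)
    qed
    then show ?thesis by (auto simp: W_def k_def)
  qed
qed

section \<open>Deflation\<close>

lemma frob2_diag_ext: "frob2 (diag_ext s A) = (cmod s)\<^sup>2 + frob2 A"
proof -
  have "col (diag_ext s A) 0 = vCons s (0\<^sub>v (dim_row A))"
    by (intro eq_vecI) (auto simp: diag_ext_def vec_index_vCons)
  moreover have "col (diag_ext s A) (Suc j) = vCons 0 (col A j)" if "j < dim_col A" for j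
    using that by (intro eq_vecI) (auto simp: diag_ext_def vec_index_vCons)
  ultimately show ?thesis
    unfolding frob2_def diag_ext_dim sum.lessThan_Suc_shift by simp
qed

lemma vec_SucE:
  assumes "x \<in> carrier_vec (Suc n)"
  obtains a y where "x = vCons a y" "y \<in> carrier_vec n"
  using assms by (cases x rule: vec_cases) auto

text \<open>The first coordinate and the rest decouple in every norm, so the cap splits into one
  condition on \<open>s\<close> and one on \<open>G\<close>, and the corner consumes the power
  s^2.\<close>

lemma feasible_diag_ext:
  "feasible (Suc n) (Suc m) P \<tau> (diag_ext (complex_of_real s) G) \<longleftrightarrow>
     feasible n m (P - s\<^sup>2) \<tau> G \<and> s\<^sup>2 \<le> \<tau>"
proof (cases "G \<in> carrier_mat n m")
  case False
  then show ?thesis by (simp add: feasible_iff)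
next
  case G: True
  have eq: "vnorm2 (mat_adjoint (diag_ext (complex_of_real s) G) *\<^sub>v vCons a y)
      = s\<^sup>2 * (cmod a)\<^sup>2 + vnorm2 (mat_adjoint G *\<^sub>v y)" if "y \<in> carrier_vec n" for a y
    using that G
    by (simp add: diag_ext_adjoint diag_ext_mult_vec[of _ m n] norm_mult power_mult_distrib)
  have "(\<forall>x \<in> carrier_vec (Suc n). vnorm2 (mat_adjoint (diag_ext (complex_of_real s) G) *\<^sub>v x) \<le> \<tau> * vnorm2 x)
      \<longleftrightarrow> (\<forall>y \<in> carrier_vec n. vnorm2 (mat_adjoint G *\<^sub>v y) \<le> \<tau> * vnorm2 y) \<and> s\<^sup>2 \<le> \<tau>"
    (is "?l \<longleftrightarrow> ?r \<and> _")
  proof (intro iffI conjI ballI; (elim conjE)?)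
    assume l: ?l
    show "s\<^sup>2 \<le> \<tau>" using l[rule_format, of "vCons 1 (0\<^sub>v n)"] eq[of "0\<^sub>v n" 1] by simp
        (metis add_increasing2 order_trans vnorm2_nonneg le_add_same_cancel1)
    fix y :: "complex vec" assume "y \<in> carrier_vec n"
    then show "vnorm2 (mat_adjoint G *\<^sub>v y) \<le> \<tau> * vnorm2 y"
      using l[rule_format, of "vCons 0 y"] eq[of y 0] by simp
  next
    fix x :: "complex vec" assume r: ?r "s\<^sup>2 \<le> \<tau>" and "x \<in> carrier_vec (Suc n)"
    then obtain a y where x: "x = vCons a y" and y: "y \<in> carrier_vec n" by (elim vec_SucE)
    show "vnorm2 (mat_adjoint (diag_ext (complex_of_real s) G) *\<^sub>v x) \<le> \<tau> * vnorm2 x"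
      using r y mult_right_mono[OF r(2), of "(cmod a)\<^sup>2"] eq[OF y, of a]
      by (simp add: x distrib_left add_mono)
  qed
  then show ?thesis
    using G by (auto simp: feasible_iff frob2_diag_ext)
qed

text \<open>Left multiplication by \<open>U\<close> only replaces the test vector by its image under
  the adjoint of \<open>U\<close>, a norm preserving bijection.\<close>

lemma feasible_unitary_mult:
  assumes U: "unitary_mat N U" and G: "G \<in> carrier_mat N L"
  shows "feasible N L P \<tau> (U * G) \<longleftrightarrow> feasible N L P \<tau> G"
proof -
  note u = unitary_matD[OF U]
  have "mat_trace (U * G * mat_adjoint (U * G)) = mat_trace (mat_adjoint (mat_adjoint U) * (G * mat_adjoint G) * mat_adjoint U)"
    using u(1) G by (simp add: mat_adjoint_mult_dim assoc_mult_mat_dim)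
  also have "\<dots> = mat_trace (G * mat_adjoint G)"
    using G by (intro mat_trace_unitary[OF unitary_mat_adjoint[OF U]]) simp
  finally have frob: "frob2 (U * G) = frob2 G" unfolding mat_trace_mult_adjoint by simp
  have eq: "mat_adjoint (U * G) *\<^sub>v x = mat_adjoint G *\<^sub>v (mat_adjoint U *\<^sub>v x)"
    "vnorm2 (mat_adjoint U *\<^sub>v x) = vnorm2 x" if "x \<in> carrier_vec N" for x
    using that u(1) G vnorm2_unitary[OF unitary_mat_adjoint[OF U] that]
    by (simp_all add: mat_adjoint_mult_dim assoc_mult_mat_vec_dim)
  have "(\<forall>x \<in> carrier_vec N. vnorm2 (mat_adjoint (U * G) *\<^sub>v x) \<le> \<tau> * vnorm2 x) \<longleftrightarrow>
      (\<forall>x \<in> carrier_vec N. vnorm2 (mat_adjoint G *\<^sub>v x) \<le> \<tau> * vnorm2 x)" (is "?l \<longleftrightarrow> ?r")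
  proof
    assume l: ?l
    show ?r
    proof
      fix x :: "complex vec" assume x: "x \<in> carrier_vec N"
      then show "vnorm2 (mat_adjoint G *\<^sub>v x) \<le> \<tau> * vnorm2 x"
        using l[rule_format, of "U *\<^sub>v x"] eq(1)[of "U *\<^sub>v x"] U u(1) by (simp add: vnorm2_unitary[OF U])
    qed
  next
    assume r: ?r
    show ?l
    proof
      fix x :: "complex vec" assume x: "x \<in> carrier_vec N"
      then show "vnorm2 (mat_adjoint (U * G) *\<^sub>v x) \<le> \<tau> * vnorm2 x"
        using r[rule_format, of "mat_adjoint U *\<^sub>v x"] eq[OF x] u(1) by simp
    qed
  qed
  then show ?thesis using u(1) G by (auto simp: feasible_iff frob)
qed

lemma objective_diag_ext:
  assumes U: "unitary_mat (Suc n) U" and V: "unitary_mat (Suc m) V"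
    and Q: "Q \<in> carrier_mat n n" and G: "G \<in> carrier_mat n m"
  shows "objective (U * diag_ext k Q * mat_adjoint U) (U * diag_ext s G * mat_adjoint V)
    = V * diag_ext (cnj s * k * s) (objective Q G) * mat_adjoint V"
proof -
  note u = unitary_matD(1)[OF U] and v = unitary_matD(1)[OF V]
  have "objective (U * diag_ext k Q * mat_adjoint U) (U * diag_ext s G * mat_adjoint V)
      = V * (mat_adjoint (diag_ext s G) * (diag_ext k Q * (diag_ext s G * mat_adjoint V)))"
    unfolding objective_def using u v Q G
      unitary_mat_cancel(1)[OF U, of "diag_ext s G * mat_adjoint V" "Suc m"]
      unitary_mat_cancel(1)[OF U, of "diag_ext k Q * (diag_ext s G * mat_adjoint V)" "Suc m"]
    by (simp add: mat_adjoint_mult_dim assoc_mult_mat_dim)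
  also have "\<dots> = V * (mat_adjoint (diag_ext s G) * diag_ext k Q * diag_ext s G) * mat_adjoint V"
    using u v Q G by (simp add: assoc_mult_mat_dim)
  also have "mat_adjoint (diag_ext s G) * diag_ext k Q * diag_ext s G
      = diag_ext (cnj s * k * s) (objective Q G)"
    unfolding objective_def using Q G
    by (simp add: diag_ext_adjoint diag_ext_mult[of _ m n _ n] diag_ext_mult[of _ m n _ m])
  finally show ?thesis .
qed

lemma quad_form_diag_ext:
  assumes "M \<in> carrier_mat n n" "y \<in> carrier_vec n"
  shows "quad_form (diag_ext k M) (vCons a y) = Re k * (cmod a)\<^sup>2 + quad_form M y"
proof -
  have "a * cnj a = complex_of_real ((cmod a)\<^sup>2)"
    by (simp add: complex_norm_square del: of_real_power)
  then have "Re (k * a * cnj a) = Re k * (cmod a)\<^sup>2"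
    by (simp only: mult.assoc) simp
  then show ?thesis
    using assms by (simp add: quad_form_def diag_ext_mult_vec[of _ n n])
qed

lemma quad_form_unitary_diag_ext:
  assumes "unitary_mat (Suc n) V" "M \<in> carrier_mat n n" "x \<in> carrier_vec (Suc n)"
    "mat_adjoint V *\<^sub>v x = vCons a y" "y \<in> carrier_vec n"
  shows "quad_form (V * diag_ext k M * mat_adjoint V) x = Re k * (cmod a)\<^sup>2 + quad_form M y"
  using assms quad_form_congruence[of "diag_ext k M" "Suc n" "mat_adjoint V" "Suc n" x]
    unitary_matD(1)[OF assms(1)] quad_form_diag_ext[OF assms(2,5)]
  by simp

text \<open>A better point for the inner block, bordered with the same \<open>s\<close>, would be
  better for the whole problem: both bordered objectives have the same corner entry, so order and
  equality carry over from the inner blocks.\<close>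

lemma pareto_optimal_deflate:
  assumes Q: "hermitian_mat (Suc n) (U * diag_ext k Q' * mat_adjoint U)" and Q'h: "hermitian_mat n Q'"
    and U: "unitary_mat (Suc n) U" and V: "unitary_mat (Suc m) V" and F': "F' \<in> carrier_mat n m"
    and par: "pareto_optimal (Suc n) (Suc m) P \<tau> (U * diag_ext k Q' * mat_adjoint U)
      (U * diag_ext (complex_of_real s) F' * mat_adjoint V)"
  shows "pareto_optimal n m (P - s\<^sup>2) \<tau> Q' F'" and "s\<^sup>2 \<le> \<tau>"
proof -
  note Q' = hermitian_matD(1)[OF Q'h] and u = unitary_matD(1)[OF U] and v = unitary_matD(1)[OF V]
  let ?lift = "\<lambda>G. U * diag_ext (complex_of_real s) G * mat_adjoint V"
  have feas: "feasible (Suc n) (Suc m) P \<tau> (?lift G) \<longleftrightarrow> feasible n m (P - s\<^sup>2) \<tau> G \<and> s\<^sup>2 \<le> \<tau>"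
    if "G \<in> carrier_mat n m" for G
    using that u feasible_mult_unitary[OF V, of "U * diag_ext (complex_of_real s) G" "Suc n"]
      feasible_unitary_mult[OF U, of "diag_ext (complex_of_real s) G" "Suc m"]
    by (simp add: feasible_diag_ext)
  have F'f: "feasible n m (P - s\<^sup>2) \<tau> F'" and s: "s\<^sup>2 \<le> \<tau>"
    using par feas[OF F'] by (auto simp: pareto_optimal_def)
  show "s\<^sup>2 \<le> \<tau>" by (rule s)
  have "objective Q' G = objective Q' F'"
    if G: "feasible n m (P - s\<^sup>2) \<tau> G" and le: "loewner_le m (objective Q' F') (objective Q' G)" for G
  proof -
    have Gc: "G \<in> carrier_mat n m" using G by (simp add: feasible_def)
    have oc: "objective Q' H \<in> carrier_mat m m" if "H \<in> carrier_mat n m" for H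
      using that Q' by (simp add: objective_def)
    let ?t = "cnj (complex_of_real s) * k * complex_of_real s"
    have "objective (U * diag_ext k Q' * mat_adjoint U) (?lift G)
        = objective (U * diag_ext k Q' * mat_adjoint U) (?lift F')"
    proof (rule pareto_optimalD[OF Q par])
      show "feasible (Suc n) (Suc m) P \<tau> (?lift G)" using feas[OF Gc] G s by simp
      fix x :: "complex vec" assume x: "x \<in> carrier_vec (Suc m)"
      have "mat_adjoint V *\<^sub>v x \<in> carrier_vec (Suc m)" using v by simp
      then obtain a y where y: "mat_adjoint V *\<^sub>v x = vCons a y" "y \<in> carrier_vec m"
        by (elim vec_SucE)
      show "quad_form (objective (U * diag_ext k Q' * mat_adjoint U) (?lift F')) x
          \<le> quad_form (objective (U * diag_ext k Q' * mat_adjoint U) (?lift G)) x"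
        unfolding objective_diag_ext[OF U V Q' F'] objective_diag_ext[OF U V Q' Gc]
          quad_form_unitary_diag_ext[OF V oc[OF F'] x y] quad_form_unitary_diag_ext[OF V oc[OF Gc] x y]
        using le y(2) by (simp add: loewner_le_iff)
    qed
    \<comment> \<open>Equality of the full objectives is stripped of \<open>V\<close> and then of
      the common corner.\<close>
    then have "mat_adjoint V * (V * diag_ext ?t (objective Q' G) * mat_adjoint V) * V
        = mat_adjoint V * (V * diag_ext ?t (objective Q' F') * mat_adjoint V) * V"
      unfolding objective_diag_ext[OF U V Q' F'] objective_diag_ext[OF U V Q' Gc] by simp
    then have eq: "diag_ext ?t (objective Q' G) = diag_ext ?t (objective Q' F')"
      using oc[OF Gc] oc[OF F'] by (simp add: unitary_mat_cancel_both[OF V V])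
    show ?thesis
    proof (rule eq_matI)
      fix i j assume "i < dim_row (objective Q' F')" "j < dim_col (objective Q' F')"
      then show "objective Q' G $$ (i, j) = objective Q' F' $$ (i, j)"
        using arg_cong[OF eq, of "\<lambda>M. M $$ (Suc i, Suc j)"] oc[OF Gc] oc[OF F'] by simp
    qed (use oc[OF Gc] oc[OF F'] in auto)
  qed
  then show "pareto_optimal n m (P - s\<^sup>2) \<tau> Q' F'"
    using F'f by (auto simp: pareto_optimal_def)
qed

text \<open>Induction on \<open>N\<close> by deflating one singular pair. \<open>L\<close>,
  \<open>P\<close>, \<open>Q\<close> and \<open>F\<close> are generalised because deflation removes
  a column, spends power and replaces both matrices by blocks.\<close>

lemma pareto_structure:
  assumes "psd_mat N Q" "\<tau> > 0" "pareto_optimal N L P \<tau> Q F"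
  shows "\<exists>U D \<Lambda> V. descending_evd N Q U D \<and> \<Lambda> \<in> carrier_mat N L \<and> diagonal_mat \<Lambda> \<and>
    (\<forall>i < min N L. 0 \<le> \<Lambda> $$ (i, i) \<and> \<Lambda> $$ (i, i) \<le> complex_of_real (sqrt \<tau>)) \<and>
    unitary_mat L V \<and> F = U * \<Lambda> * mat_adjoint V"
  using assms
proof (induction N arbitrary: L P Q F)
  case 0
  then obtain U D where "descending_evd 0 Q U D"
    using hermitian_descending_evd psd_mat_iff by blast
  moreover have "F \<in> carrier_mat 0 L" using 0 by (simp add: pareto_optimal_def feasible_def)
  then have "F = U * 0\<^sub>m 0 L * mat_adjoint (1\<^sub>m L)"
    using unitary_matD(1)[OF descending_evdD(1)[OF calculation]] by (intro eq_matI) auto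
  ultimately show ?case
    by (intro exI[of _ U] exI[of _ D] exI[of _ "0\<^sub>m 0 L"] exI[of _ "1\<^sub>m L"])
       (simp add: unitary_mat_one diagonal_mat_def)
next
  case (Suc n)
  have qh: "hermitian_mat (Suc n) Q" using Suc.prems by (simp add: psd_mat_iff)
  then obtain U D where evd: "descending_evd (Suc n) Q U D" using hermitian_descending_evd by blast
  have F: "F \<in> carrier_mat (Suc n) L" using Suc.prems by (simp add: pareto_optimal_def feasible_def)
  show ?case
  proof (cases L)
    case 0
    then have "F = U * 0\<^sub>m (Suc n) 0 * mat_adjoint (1\<^sub>m 0)"
      using F unitary_matD(1)[OF descending_evdD(1)[OF evd]] by (intro eq_matI) auto
    then show ?thesis
      using evd 0
      by (intro exI[of _ U] exI[of _ D] exI[of _ "0\<^sub>m (Suc n) 0"] exI[of _ "1\<^sub>m 0"])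
         (simp add: unitary_mat_one diagonal_mat_def)
  next
    case (Suc m)
    note L = this
    note q = hermitian_matD[OF qh] and d = descending_evdD[OF evd]
    define k where "k = D $$ (0, 0)"
    have kr: "k \<in> \<real>" using d(5)[of 0] by (metis Reals_of_real k_def zero_less_Suc)
    have top: "quad_form Q x \<le> Re k * vnorm2 x" if "x \<in> carrier_vec (Suc n)" for x
      unfolding k_def using evd that by (rule evd_quad_form_le) simp
    obtain u v s where u: "u \<in> carrier_vec (Suc n)" "vnorm2 u = 1" "Q *\<^sub>v u = k \<cdot>\<^sub>v u"
      and v: "v \<in> carrier_vec (Suc m)" "vnorm2 v = 1"
      and s: "0 \<le> s" "F *\<^sub>v v = complex_of_real s \<cdot>\<^sub>v u" "mat_adjoint F *\<^sub>v u = complex_of_real s \<cdot>\<^sub>v v"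
      using pareto_singular_pair[OF Suc.prems(1) Suc.prems(3)[unfolded L] Suc.prems(2) evd]
      by (auto simp: k_def)
    obtain U1 where U1: "unitary_mat (Suc n) U1" "col U1 0 = u"
      using unitary_mat_with_first_col[OF u(1,2)] by blast
    obtain V1 where V1: "unitary_mat (Suc m) V1" "col V1 0 = v"
      using unitary_mat_with_first_col[OF v] by blast
    obtain F' where F': "F' \<in> carrier_mat n m" "F = U1 * diag_ext (complex_of_real s) F' * mat_adjoint V1"
      using svd_deflate[OF F[unfolded L] U1 V1 s(2)] s(3) by auto
    obtain Q' where Q': "Q' \<in> carrier_mat n n" "Q = U1 * diag_ext k Q' * mat_adjoint U1"
      using svd_deflate[OF q(1) U1 U1 u(3)] u(3) q(2) kr by (auto simp: Reals_cnj_iff)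
    have "mat_adjoint U1 * Q * U1 = diag_ext k Q'"
      unfolding Q'(2) using Q'(1) U1 by (intro unitary_mat_cancel_both) auto
    then have Q'h: "hermitian_mat n Q'"
      using hermitian_congruence[OF qh unitary_matD(1)[OF U1(1)]] hermitian_mat_diag_extD by simp
    \<comment> \<open>Positivity passes to the block by padding \<open>x\<close> with a zero first
      coordinate.\<close>
    have "0 \<le> quad_form Q' x" if x: "x \<in> carrier_vec n" for x
    proof -
      let ?y = "U1 *\<^sub>v vCons 0 x"
      have y: "?y \<in> carrier_vec (Suc n)" using unitary_matD(1)[OF U1(1)] by simp
      have "mat_adjoint U1 *\<^sub>v ?y = vCons 0 x" using U1 x by simp
      then have "quad_form Q ?y = quad_form Q' x"
        using quad_form_unitary_diag_ext[OF U1(1) Q'(1) y _ x, of 0 k] Q'(2) by simp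
      moreover have "0 \<le> quad_form Q ?y" using Suc.prems(1) y unfolding psd_mat_iff by blast
      ultimately show ?thesis by simp
    qed
    then have Q'p: "psd_mat n Q'" using Q'h by (simp add: psd_mat_iff)
    have par: "pareto_optimal n m (P - s\<^sup>2) \<tau> Q' F'" and s\<tau>: "s\<^sup>2 \<le> \<tau>"
      using pareto_optimal_deflate[OF _ Q'h U1(1) V1(1) F'(1)] qh Suc.prems(3)
      unfolding L F'(2) Q'(2) by blast+
    obtain U2 D2 \<Lambda> V2 where IH: "descending_evd n Q' U2 D2" "\<Lambda> \<in> carrier_mat n m" "diagonal_mat \<Lambda>"
      "\<forall>i < min n m. 0 \<le> \<Lambda> $$ (i, i) \<and> \<Lambda> $$ (i, i) \<le> complex_of_real (sqrt \<tau>)"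
      "unitary_mat m V2" "F' = U2 * \<Lambda> * mat_adjoint V2"
      using Suc.IH[OF Q'p Suc.prems(2) par] by blast
    \<comment> \<open>At a unit eigenvector the form equals the eigenvalue, so the Rayleigh bound
      shows that \<open>k\<close> may stand first.\<close>
    have "Re l \<le> Re k" if "x \<in> carrier_vec (Suc n)" "vnorm2 x = 1" "Q *\<^sub>v x = l \<cdot>\<^sub>v x" for l x
      using top[OF that(1)] that by (simp add: quad_form_def cscalar_prod_self)
    then have evd': "descending_evd (Suc n) Q (U1 * diag_ext 1 U2) (diag_ext k D2)"
      using descending_evd_diag_ext[OF U1(1) IH(1) kr Q'(2)] by blast
    have Feq: "F = (U1 * diag_ext 1 U2) * diag_ext (complex_of_real s) \<Lambda> * mat_adjoint (V1 * diag_ext 1 V2)"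
      unfolding F'(2) IH(6)
      using diag_ext_unitary_mult[OF U1(1) V1(1)] unitary_matD(1) descending_evdD(1)[OF IH(1)] IH(2,5) by blast
    have V: "unitary_mat (Suc m) (V1 * diag_ext 1 V2)"
      using V1(1) IH(5) by (intro unitary_mat_mult unitary_diag_ext)
    have "s \<le> sqrt \<tau>" using s\<tau> by (rule real_le_rsqrt)
    then have "0 \<le> diag_ext (complex_of_real s) \<Lambda> $$ (i, i) \<and>
        diag_ext (complex_of_real s) \<Lambda> $$ (i, i) \<le> complex_of_real (sqrt \<tau>)"
      if "i < min (Suc n) (Suc m)" for i
      using that s(1) IH(2,4) by (cases i) (auto simp: less_eq_complex_def)
    then show ?thesis
      using evd' V IH(2,3) Feq unfolding L
      by (intro exI[of _ "U1 * diag_ext 1 U2"] exI[of _ "diag_ext k D2"]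
          exI[of _ "diag_ext (complex_of_real s) \<Lambda>"] exI[of _ "V1 * diag_ext 1 V2"])
         (simp add: diag_ext_diagonal)
  qed
qed

theorem lemma2:
  fixes N L :: nat and P \<tau> :: real and Q F :: "complex mat"
  assumes "psd_mat N Q" and "P > 0" and "\<tau> > 0"
    and "pareto_optimal N L P \<tau> Q F"
  shows "\<exists>U\<^sub>Q \<Lambda>\<^sub>Q \<Lambda>\<^sub>F V.
           descending_evd N Q U\<^sub>Q \<Lambda>\<^sub>Q \<and>
           \<Lambda>\<^sub>F \<in> carrier_mat N L \<and> diagonal_mat \<Lambda>\<^sub>F \<and>
           (\<forall>i < min N L. 0 \<le> \<Lambda>\<^sub>F $$ (i, i) \<and> \<Lambda>\<^sub>F $$ (i, i) \<le> complex_of_real (sqrt \<tau>)) \<and>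
           unitary_mat L V \<and>
           F = U\<^sub>Q * \<Lambda>\<^sub>F * mat_adjoint V"
  using pareto_structure[OF assms(1,3,4)] .

end
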